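(* The sets $Y_{br}(n;\lambda)$ ($n\in\mathbb N$, $\lambda$ an integer partition) form a Pascal $(\mathcal Y,0)$-array, where $\mathcal Y$ is the Young graph and $0$ is the empty integer partition. The corresponding Catalan sequence of sets is $(\mathcal C_{br}(n))_{n\in\mathbb N}$: for each $n$ the bra-ket decomposition gives a bijection $\mathcal C_{br}(n)\to\bigsqcup_\lambda Y_{br}(n;\lambda)\times Y_{br}(n;\lambda)$.
   Context: $\mathbb N=\{0,1,2,\dots\}$. The Young graph $\mathcal Y$ is the undirected graph whose vertices are the integer partitions $\lambda=(\lambda_1\ge\lambda_2\ge\cdots)$ (all but finitely many entries zero), with an edge between $\lambda$ and $\lambda'$ if $\lambda-\lambda'$ has the form $(0,\dots,0,\pm1,0,0,\dots)$. An undirected edge is regarded as two opposite directed edges. For a rooted graph $(G,v_0)$ with vertices $V$, directed edges $E$, and initial/final maps $i,f:E\to V$, a Pascal $(G,v_0)$-array is a family of sets $Y(n;v)$, $n\in\mathbb N$, $v\in V$, with $Y(0;v_0)$ a singleton and $Y(0;v)=\emptyset$ for $v\neq v_0$, for which there are injective edge maps $\phi'_e:Y(n-1;i(e))\hookrightarrow Y(n;f(e))$ ($e\in E$, $n\ge1$) such that $Y(n;v)=\bigsqcup_{e:\,f(e)=v}\phi'_e(Y(n-1;i(e)))$ (disjoint union). Let $\underline n=\{1,\dots,n\}$ and $\underline{n'}=\{1',\dots,n'\}$. $\mathcal C_{br}(n)$ is the set of pair partitions of $\underline n\cup\underline{n'}$ (set partitions all of whose parts have exactly two elements). A half pair partition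 of $\underline n$ is a set partition of $\underline n$ into pairs and singletons; the singletons are called propagating components. For $\lambda$ an integer partition of $l$ with $n-l$ even, $Y_{br}(n;\lambda)$ is the set of pairs $(\sigma,T)$ with $\sigma$ a half pair partition of $\underline n$ with exactly $l$ singletons and $T$ a standard Young tableau of shape $\lambda$; if $n-l$ is odd, $Y_{br}(n;\lambda)=\emptyset$. Bra-ket decomposition: given $p\in\mathcal C_{br}(n)$, the parts contained in $\underline n$ are the pairs of a half pair partition of $\underline n$, the remaining elements of $\underline n$ being singletons; similarly for $\underline{n'}$ (identified with $\underline n$). The two half pair partitions have the same number $l$ of singletons, and the parts of $p$ joining $\underline n$ to $\underline{n'}$ match these (each set of singletons being ordered increasingly), defining a permutation in $S_l$; the Robinson–Schensted correspondence turns this into a pair of standard tableaux of the same shape $\lambda$, the first attached to the first half pair partition and the second to the second. *)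

theory Defs
  imports "Graph_Theory.Digraph" "HOL-Library.Disjoint_Sets"
begin

section \<open>Pascal arrays and Catalan sequences of sets\<close>

text \<open>
  Undirected graphs are digraphs containing both orientations of every edge; the initial and
  final maps are \<^const>\<open>tail\<close> and \<^const>\<open>head\<close>. The edge maps are indexed by the level \<open>n\<close> as
  well as by the edge.
\<close>

definition pascal_array ::
    "('v, 'e) pre_digraph \<Rightarrow> 'v \<Rightarrow> (nat \<Rightarrow> 'v \<Rightarrow> 'y set) \<Rightarrow> bool" where
  "pascal_array G v0 Y \<longleftrightarrow>
     wf_digraph G \<and> v0 \<in> verts G \<and>
     is_singleton (Y 0 v0) \<and> (\<forall>v\<in>verts G. v \<noteq> v0 \<longrightarrow> Y 0 v = {}) \<and>
     (\<exists>\<phi> :: nat \<Rightarrow> 'e \<Rightarrow> 'y \<Rightarrow> 'y. \<forall>n\<ge>1.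
        (\<forall>e\<in>arcs G. \<phi> n e \<in> Y (n - 1) (tail G e) \<rightarrow> Y n (head G e) \<and>
                    inj_on (\<phi> n e) (Y (n - 1) (tail G e))) \<and>
        (\<forall>v\<in>verts G.
           Y n v = (\<Union>e\<in>in_arcs G v. \<phi> n e ` Y (n - 1) (tail G e)) \<and>
           disjoint_family_on (\<lambda>e. \<phi> n e ` Y (n - 1) (tail G e)) (in_arcs G v)))"

definition catalan_sets ::
    "('v, 'e) pre_digraph \<Rightarrow> (nat \<Rightarrow> 'v \<Rightarrow> 'y set) \<Rightarrow> nat \<Rightarrow> ('v \<times> 'y \<times> 'y) set" where
  "catalan_sets G Y n = (SIGMA v : verts G. Y n v \<times> Y n v)"

section \<open>The Young graph\<close>

text \<open>Parts are indexed from \<open>0\<close>, so the first part of \<open>\<mu>\<close> is \<open>\<mu> 0\<close>.\<close>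

definition int_partitions :: "(nat \<Rightarrow> nat) set" where
  "int_partitions = {\<mu>. antimono \<mu> \<and> finite {i. \<mu> i \<noteq> 0}}"

definition partition_size :: "(nat \<Rightarrow> nat) \<Rightarrow> nat" where
  "partition_size \<mu> = (\<Sum>i | \<mu> i \<noteq> 0. \<mu> i)"

definition young_adjacent :: "(nat \<Rightarrow> nat) \<Rightarrow> (nat \<Rightarrow> nat) \<Rightarrow> bool" where
  "young_adjacent \<mu> \<nu> \<longleftrightarrow>
     (\<exists>i. \<exists>s\<in>{1, -1}. \<forall>j. int (\<mu> j) - int (\<nu> j) = (if j = i then s else 0))"

definition young_graph :: "(nat \<Rightarrow> nat, (nat \<Rightarrow> nat) \<times> (nat \<Rightarrow> nat)) pre_digraph" where
  "young_graph =
     \<lparr>verts = int_partitions,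
      arcs = {(\<mu>, \<nu>). \<mu> \<in> int_partitions \<and> \<nu> \<in> int_partitions \<and> young_adjacent \<mu> \<nu>},
      tail = fst, head = snd\<rparr>"

section \<open>Standard Young tableaux\<close>

text \<open>A tableau is the list of its nonempty rows, longest row first.\<close>

type_synonym tableau = "nat list list"

definition tableau_shape :: "tableau \<Rightarrow> nat \<Rightarrow> nat" where
  "tableau_shape T i = (if i < length T then length (T ! i) else 0)"

definition standard_tableaux :: "(nat \<Rightarrow> nat) \<Rightarrow> tableau set" where
  "standard_tableaux \<mu> =
     {T. [] \<notin> set T \<and> tableau_shape T = \<mu> \<and>
         distinct (concat T) \<and> set (concat T) = {1..partition_size \<mu>} \<and>
         (\<forall>r\<in>set T. sorted_wrt (<) r) \<and>
         (\<forall>i j. Suc i < length T \<and> j < length (T ! Suc i) \<longrightarrow> T ! i ! j < T ! Suc i ! j)}"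

section \<open>The Robinson--Schensted correspondence\<close>

text \<open>
  \<open>row_insert x r\<close> replaces the leftmost entry of \<open>r\<close> exceeding \<open>x\<close> and returns it as the bumped
  entry; if there is none, \<open>x\<close> is appended.
\<close>

fun row_insert :: "nat \<Rightarrow> nat list \<Rightarrow> nat option \<times> nat list" where
  "row_insert x [] = (None, [x])"
| "row_insert x (y # ys) =
     (if x < y then (Some y, x # ys)
      else (case row_insert x ys of (b, zs) \<Rightarrow> (b, y # zs)))"

text \<open>The second component of the result is the index of the row in which the new box appears.\<close>

fun tableau_insert :: "nat \<Rightarrow> tableau \<Rightarrow> tableau \<times> nat" where
  "tableau_insert x [] = ([[x]], 0)"
| "tableau_insert x (r # rs) =
     (case row_insert x r of
        (None, r') \<Rightarrow> (r' # rs, 0)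
      | (Some y, r') \<Rightarrow> (case tableau_insert y rs of (rs', i) \<Rightarrow> (r' # rs', Suc i)))"

definition append_to_row :: "nat \<Rightarrow> nat \<Rightarrow> tableau \<Rightarrow> tableau" where
  "append_to_row i k Q = (if i < length Q then Q[i := Q ! i @ [k]] else Q @ [[k]])"

definition rs_step :: "nat \<times> nat \<Rightarrow> tableau \<times> tableau \<Rightarrow> tableau \<times> tableau" where
  "rs_step = (\<lambda>(k, x) (P, Q). case tableau_insert x P of (P', i) \<Rightarrow> (P', append_to_row i k Q))"

text \<open>
  A permutation of \<open>{1..l}\<close> is given by its word of values; the result is the pair of the insertion
  tableau and the recording tableau, in this order.
\<close>

definition robinson_schensted :: "nat list \<Rightarrow> tableau \<times> tableau" where
  "robinson_schensted w = fold rs_step (List.enumerate 1 w) ([], [])"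

section \<open>Pair partitions and their bra-ket decomposition\<close>

text \<open>\<^term>\<open>Inl i\<close> is the point \<open>i\<close> and \<^term>\<open>Inr i\<close> is the primed point \<open>i'\<close>.\<close>

definition C_br :: "nat \<Rightarrow> (nat + nat) set set set" where
  "C_br n = {p. partition_on ({1..n} <+> {1..n}) p \<and> (\<forall>A\<in>p. card A = 2)}"

definition half_pair_partitions :: "nat \<Rightarrow> nat set set set" where
  "half_pair_partitions n = {\<sigma>. partition_on {1..n} \<sigma> \<and> (\<forall>A\<in>\<sigma>. card A = 1 \<or> card A = 2)}"

definition propagating :: "nat set set \<Rightarrow> nat set" where
  "propagating \<sigma> = {i. {i} \<in> \<sigma>}"

definition Y_br :: "nat \<Rightarrow> (nat \<Rightarrow> nat) \<Rightarrow> (nat set set \<times> tableau) set" where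
  "Y_br n \<mu> =
     (if even (int n - int (partition_size \<mu>))
      then {\<sigma> \<in> half_pair_partitions n. card (propagating \<sigma>) = partition_size \<mu>}
             \<times> standard_tableaux \<mu>
      else {})"

text \<open>
  The half of a pair partition on the unprimed points (\<open>emb = Inl\<close>) or on the primed points
  (\<open>emb = Inr\<close>).
\<close>

definition half_of :: "nat \<Rightarrow> (nat \<Rightarrow> nat + nat) \<Rightarrow> (nat + nat) set set \<Rightarrow> nat set set" where
  "half_of n emb p =
     {A. emb ` A \<in> p} \<union> {{i} | i. i \<in> {1..n} \<and> (\<forall>A. emb ` A \<in> p \<longrightarrow> i \<notin> A)}"

text \<open>
  The word of the permutation sending \<open>k\<close> to \<open>m\<close> if the \<open>k\<close>-th propagating point of the unprimed
  half is joined to the \<open>m\<close>-th propagating point of the primed half. Taking the inverse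
  permutation instead would exchange the two tableaux.
\<close>

definition propagating_word :: "nat \<Rightarrow> (nat + nat) set set \<Rightarrow> nat list" where
  "propagating_word n p =
     map (\<lambda>a. card {c \<in> propagating (half_of n Inr p). c \<le> (THE b. {Inl a, Inr b} \<in> p)})
       (sorted_list_of_set (propagating (half_of n Inl p)))"

definition bra_ket ::
    "nat \<Rightarrow> (nat + nat) set set \<Rightarrow>
       (nat \<Rightarrow> nat) \<times> (nat set set \<times> tableau) \<times> (nat set set \<times> tableau)" where
  "bra_ket n p =
     (case robinson_schensted (propagating_word n p) of
        (P, Q) \<Rightarrow> (tableau_shape P, (half_of n Inl p, P), (half_of n Inr p, Q)))"

end

theory Submission
  imports Defs "HOL-Library.Equipollence" "HOL-Library.Multiset"
begin

text \<open>
  Everything rests on one property of row insertion: it is a bijection. Inserting \<open>x\<close> into a tableau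
  adds one box to its shape, and from the resulting tableau and the row of that box both \<open>x\<close> and
  the old tableau are recovered by reverse bumping, which can be started from any corner
  (\<open>increasing_tableau_insert\<close>, \<open>tableau_insert_unique\<close>, \<open>tableau_insert_exists\<close>).

  Pascal array. Write \<open>H(n, l)\<close> for the half pair partitions of \<open>{1..n}\<close> with \<open>l\<close> singletons and
  \<open>T(\<mu>)\<close> for the standard tableaux of shape \<open>\<mu>\<close>, so that \<open>Y(n; \<mu>) = H(n, |\<mu>|) \<times> T(\<mu>)\<close>. With
  \<open>l = |\<mu>|\<close>, looking at the last point splits \<open>H(n + 1, l)\<close> into a copy of \<open>H(n, l - 1)\<close>, where
  that point is a singleton (this part is empty if \<open>l = 0\<close>), and a copy of
  \<open>H(n, l + 1) \<times> {1..l + 1}\<close>, where it is paired and the number is the rank of its partner. If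
  \<open>l > 0\<close>, removing the largest entry identifies \<open>T(\<mu>)\<close> with the disjoint union of the \<open>T(\<nu>)\<close> over all
  \<open>\<nu>\<close> with one box less. Row insertion identifies \<open>{1..l + 1} \<times> T(\<mu>)\<close> with the disjoint union of the
  \<open>T(\<nu>)\<close> over all \<open>\<nu>\<close> with one box more. Together, \<open>Y(n + 1; \<mu>)\<close> is the disjoint union of copies of
  the \<open>Y(n; \<nu>)\<close> over all neighbours \<open>\<nu>\<close> of \<open>\<mu>\<close> in the Young graph (\<open>Y_br_step\<close>).

  Catalan sequence. A pair partition is the same thing as two half pair partitions with the same
  number \<open>l\<close> of singletons and a permutation of \<open>{1..l}\<close> that matches them
  (\<open>pair_partition_determined\<close>, \<open>pair_partition_exists\<close>). The Robinson--Schensted correspondence is a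
  bijection from these permutations to pairs of standard tableaux of a common shape of size \<open>l\<close>,
  because its steps can be undone one at a time: the largest entry of the recording tableau marks
  the last box, and reverse bumping from there returns the last letter
  (\<open>robinson_schensted_inj\<close>, \<open>robinson_schensted_surj\<close>).
\<close>

section \<open>Shapes and their boxes\<close>

definition add_box :: "nat \<Rightarrow> (nat \<Rightarrow> nat) \<Rightarrow> nat \<Rightarrow> nat" where
  "add_box i \<mu> = \<mu>(i := Suc (\<mu> i))"

lemma add_box_inj [simp]: "add_box i \<mu> = add_box i \<nu> \<longleftrightarrow> \<mu> = \<nu>"
  by (auto simp: add_box_def fun_eq_iff split: if_splits)

lemma add_box_row_inj [simp]: "add_box i \<mu> = add_box j \<mu> \<longleftrightarrow> i = j"
  by (auto simp: add_box_def fun_eq_iff split: if_splits)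

lemma int_partitionsI_Suc:
  assumes "\<And>i. \<mu> (Suc i) \<le> \<mu> i" and "finite {i. \<mu> i \<noteq> 0}"
  shows "\<mu> \<in> int_partitions"
  using assms by (simp add: int_partitions_def antimono_iff_le_Suc)

lemma int_partitions_Suc_le: "\<mu> \<in> int_partitions \<Longrightarrow> \<mu> (Suc i) \<le> \<mu> i"
  by (simp add: int_partitions_def antimono_iff_le_Suc)

lemma int_partitions_finite: "\<mu> \<in> int_partitions \<Longrightarrow> finite {i. \<mu> i \<noteq> 0}"
  by (simp add: int_partitions_def)

lemma zero_int_partition: "(\<lambda>_. 0) \<in> int_partitions"
  by (simp add: int_partitions_def antimono_def)

lemma partition_size_add_box:
  assumes "\<mu> \<in> int_partitions"
  shows "partition_size (add_box i \<mu>) = Suc (partition_size \<mu>)"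
proof -
  let ?S = "insert i {j. \<mu> j \<noteq> 0}"
  have fin: "finite ?S"
    using int_partitions_finite[OF assms] by simp
  have "partition_size (add_box i \<mu>) = (\<Sum>j\<in>?S. add_box i \<mu> j)"
    unfolding partition_size_def
    by (rule sum.mono_neutral_left) (use fin in \<open>auto simp: add_box_def split: if_splits\<close>)
  also have "\<dots> = Suc (\<mu> i) + (\<Sum>j\<in>?S - {i}. \<mu> j)"
    using fin by (subst sum.remove[of _ i]) (auto simp: add_box_def intro!: sum.cong)
  also have "\<dots> = Suc (\<Sum>j\<in>?S. \<mu> j)"
    using fin by (subst sum.remove[of ?S i]) auto
  also have "(\<Sum>j\<in>?S. \<mu> j) = partition_size \<mu>"
    unfolding partition_size_def
    by (rule sum.mono_neutral_right) (use fin in auto)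
  finally show ?thesis .
qed

lemma partition_size_eq_0_iff:
  assumes "\<mu> \<in> int_partitions"
  shows "partition_size \<mu> = 0 \<longleftrightarrow> \<mu> = (\<lambda>_. 0)"
  using int_partitions_finite[OF assms] by (auto simp: partition_size_def)

definition addable :: "nat \<Rightarrow> (nat \<Rightarrow> nat) \<Rightarrow> bool" where
  "addable i \<mu> \<longleftrightarrow> i = 0 \<or> \<mu> i < \<mu> (i - 1)"

lemma add_box_in_int_partitions_iff:
  assumes "\<mu> \<in> int_partitions"
  shows "add_box i \<mu> \<in> int_partitions \<longleftrightarrow> addable i \<mu>"
proof
  assume "add_box i \<mu> \<in> int_partitions"
  from int_partitions_Suc_le[OF this, of "i - 1"] show "addable i \<mu>"
    by (cases i) (auto simp: add_box_def addable_def)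
next
  assume i: "addable i \<mu>"
  have "{j. add_box i \<mu> j \<noteq> 0} \<subseteq> insert i {j. \<mu> j \<noteq> 0}"
    by (auto simp: add_box_def)
  then have "finite {j. add_box i \<mu> j \<noteq> 0}"
    using int_partitions_finite[OF assms] by (simp add: finite_subset)
  moreover have "add_box i \<mu> (Suc j) \<le> add_box i \<mu> j" for j
    using i int_partitions_Suc_le[OF assms, of j] by (auto simp: add_box_def addable_def)
  ultimately show "add_box i \<mu> \<in> int_partitions"
    by (rule int_partitionsI_Suc[rotated])
qed

definition upper_covers :: "(nat \<Rightarrow> nat) \<Rightarrow> (nat \<Rightarrow> nat) set" where
  "upper_covers \<mu> = {\<nu> \<in> int_partitions. \<exists>i. \<nu> = add_box i \<mu>}"

definition lower_covers :: "(nat \<Rightarrow> nat) \<Rightarrow> (nat \<Rightarrow> nat) set" where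
  "lower_covers \<mu> = {\<nu> \<in> int_partitions. \<exists>i. \<mu> = add_box i \<nu>}"

lemma young_adjacent_iff:
  "young_adjacent \<mu> \<nu> \<longleftrightarrow> (\<exists>i. \<mu> = add_box i \<nu>) \<or> (\<exists>i. \<nu> = add_box i \<mu>)"
proof -
  have "(\<forall>j. int (\<mu> j) - int (\<nu> j) = (if j = i then 1 else 0)) \<longleftrightarrow> \<mu> = add_box i \<nu>" for i
    by (auto simp: add_box_def fun_eq_iff)
  moreover have "(\<forall>j. int (\<mu> j) - int (\<nu> j) = (if j = i then - 1 else 0)) \<longleftrightarrow> \<nu> = add_box i \<mu>" for i
    by (auto simp: add_box_def fun_eq_iff)
  ultimately show ?thesis
    by (simp add: young_adjacent_def ex_disj_distrib)
qed

lemma young_neighbours: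
  assumes "\<nu> \<in> int_partitions"
  shows "{\<mu> \<in> int_partitions. young_adjacent \<mu> \<nu>} = lower_covers \<nu> \<union> upper_covers \<nu>"
  using assms by (auto simp: young_adjacent_iff upper_covers_def lower_covers_def)

lemma covers_disjoint:
  assumes "\<nu> \<in> int_partitions"
  shows "lower_covers \<nu> \<inter> upper_covers \<nu> = {}"
proof -
  have "partition_size \<mu> < partition_size \<nu>" if "\<mu> \<in> lower_covers \<nu>" for \<mu>
    using that by (auto simp: lower_covers_def partition_size_add_box)
  moreover have "partition_size \<mu> > partition_size \<nu>" if "\<mu> \<in> upper_covers \<nu>" for \<mu>
    using that assms by (auto simp: upper_covers_def partition_size_add_box)
  ultimately show ?thesis by fastforce
qed

section \<open>Increasing tableaux\<close>

definition row_above :: "nat list \<Rightarrow> nat list \<Rightarrow> bool" where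
  "row_above r s \<longleftrightarrow> length s \<le> length r \<and> (\<forall>j<length s. r ! j < s ! j)"

text \<open>
  Standardness with the set of entries left free. Bumping hands an entry of one row to the tableau
  formed by the rows below it, so every induction over insertion runs through tableaux whose
  entries are not an initial segment of the naturals.
\<close>

definition increasing_tableau :: "tableau \<Rightarrow> bool" where
  "increasing_tableau T \<longleftrightarrow>
     [] \<notin> set T \<and> (\<forall>r\<in>set T. sorted_wrt (<) r) \<and> successively row_above T"

text \<open>
  The value at the empty tableau makes \<^term>\<open>row_above r (first_row rs)\<close> hold vacuously when
  \<^term>\<open>r\<close> is the last row, so that the recursion below needs no case distinction.
\<close>

fun first_row :: "tableau \<Rightarrow> nat list" where
  "first_row [] = []"
| "first_row (r # rs) = r"

lemma row_above_Nil [simp]: "row_above r []"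
  by (simp add: row_above_def)

lemma increasing_tableau_Nil [simp]: "increasing_tableau []"
  by (simp add: increasing_tableau_def)

lemma increasing_tableau_Cons [simp]:
  "increasing_tableau (r # rs) \<longleftrightarrow>
     r \<noteq> [] \<and> sorted_wrt (<) r \<and> row_above r (first_row rs) \<and> increasing_tableau rs"
  by (cases rs) (auto simp: increasing_tableau_def)

lemma increasing_tableau_first_row:
  "increasing_tableau T \<Longrightarrow> sorted_wrt (<) (first_row T)"
  by (cases T) auto

lemma tableau_shape_Nil [simp]: "tableau_shape [] = (\<lambda>_. 0)"
  by (simp add: tableau_shape_def fun_eq_iff)

lemma tableau_shape_Cons_0 [simp]: "tableau_shape (r # rs) 0 = length r"
  by (simp add: tableau_shape_def)

lemma tableau_shape_Cons_Suc [simp]: "tableau_shape (r # rs) (Suc i) = tableau_shape rs i"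
  by (simp add: tableau_shape_def)

lemma tableau_shape_0: "tableau_shape T 0 = length (first_row T)"
  by (cases T) auto

lemma tableau_shape_Cons: "tableau_shape (r # rs) = case_nat (length r) (tableau_shape rs)"
  by (auto simp: fun_eq_iff split: nat.splits)

lemma tableau_shape_finite: "finite {i. tableau_shape T i \<noteq> 0}"
  by (rule finite_subset[of _ "{..<length T}"]) (auto simp: tableau_shape_def split: if_splits)

lemma increasing_tableau_shape:
  assumes "increasing_tableau T"
  shows "tableau_shape T \<in> int_partitions"
proof (rule int_partitionsI_Suc)
  show "tableau_shape T (Suc i) \<le> tableau_shape T i" for i
    using assms
  proof (induction T arbitrary: i)
    case (Cons r rs)
    then show ?case by (cases i) (auto simp: row_above_def tableau_shape_0)
  qed simp
qed (rule tableau_shape_finite)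

lemma partition_size_tableau_shape: "partition_size (tableau_shape T) = length (concat T)"
proof -
  have "partition_size (tableau_shape T) = (\<Sum>i<length T. length (T ! i))"
    unfolding partition_size_def
    by (rule sum.mono_neutral_cong_left) (auto simp: tableau_shape_def split: if_splits)
  also have "\<dots> = length (concat T)"
    by (simp add: length_concat sum_list_sum_nth atLeast0LessThan)
  finally show ?thesis .
qed

definition tableaux_of_content :: "(nat \<Rightarrow> nat) \<Rightarrow> nat set \<Rightarrow> tableau set" where
  "tableaux_of_content \<mu> S =
     {T. increasing_tableau T \<and> tableau_shape T = \<mu> \<and> distinct (concat T) \<and> set (concat T) = S}"

text \<open>
  In the definition of a standard tableau the columns are compared entry by entry. That the rows
  weakly shorten, which \<^const>\<open>row_above\<close> demands as well, is where the shape being a partition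
  enters.
\<close>

lemma standard_tableaux_eq:
  assumes "\<mu> \<in> int_partitions"
  shows "standard_tableaux \<mu> = tableaux_of_content \<mu> {1..partition_size \<mu>}"
proof -
  have "increasing_tableau T \<longleftrightarrow> [] \<notin> set T \<and> (\<forall>r\<in>set T. sorted_wrt (<) r) \<and>
      (\<forall>i j. Suc i < length T \<and> j < length (T ! Suc i) \<longrightarrow> T ! i ! j < T ! Suc i ! j)"
    if "tableau_shape T = \<mu>" for T
  proof -
    have "length (T ! Suc i) \<le> length (T ! i)" if "Suc i < length T" for i
      using int_partitions_Suc_le[OF assms, of i] that \<open>tableau_shape T = \<mu>\<close>
      by (auto simp: tableau_shape_def)
    then show ?thesis
      by (auto simp: increasing_tableau_def successively_conv_nth row_above_def)
  qed
  then show ?thesis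
    by (auto simp: standard_tableaux_def tableaux_of_content_def)
qed

text \<open>
  Every entry dominates the top entry of its column. This guarantees that reverse bumping, on its way
  up, finds a smaller entry in every row that it reaches.
\<close>

lemma increasing_tableau_bounded_below:
  assumes "increasing_tableau T" and "y \<in> set (concat T)"
  shows "\<exists>x\<in>set (first_row T). x \<le> y"
  using assms
proof (induction T)
  case (Cons r rs)
  show ?case
  proof (cases "y \<in> set r")
    case False
    with Cons obtain x where x: "x \<in> set (first_row rs)" "x \<le> y" by auto
    then obtain j where j: "j < length (first_row rs)" "first_row rs ! j = x"
      by (auto simp: in_set_conv_nth)
    then have "j < length r" "r ! j < x"
      using Cons.prems by (auto simp: row_above_def)
    with x show ?thesis by (auto intro!: bexI[of _ "r ! j"])
  qed auto
qed simp

section \<open>Row insertion is reversible\<close>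

lemma row_insert_None_iff:
  "row_insert x r = (None, r') \<longleftrightarrow> r' = r @ [x] \<and> (\<forall>z\<in>set r. z \<le> x)"
proof (induction r arbitrary: r')
  case (Cons z zs)
  obtain b zs' where "row_insert x zs = (b, zs')" by fastforce
  with Cons.IH[of "zs @ [x]"] Cons.IH[of zs'] show ?case by auto
qed auto

lemma row_insert_SomeD:
  "row_insert x r = (Some y, r') \<Longrightarrow>
     \<exists>k<length r. y = r ! k \<and> r' = r[k := x] \<and> x < y \<and> (\<forall>j<k. r ! j \<le> x)"
proof (induction r arbitrary: r')
  case (Cons z zs)
  show ?case
  proof (cases "x < z")
    case True
    with Cons.prems show ?thesis by (auto intro!: exI[of _ 0])
  next
    case False
    with Cons.prems obtain zs' where zs': "row_insert x zs = (Some y, zs')" "r' = z # zs'"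
      by (auto split: prod.splits)
    from Cons.IH[OF zs'(1)] obtain k where
      "k < length zs" "y = zs ! k" "zs' = zs[k := x]" "x < y" "\<forall>j<k. zs ! j \<le> x" by blast
    with zs' False show ?thesis
      by (intro exI[of _ "Suc k"]) (auto simp: less_Suc_eq_0_disj)
  qed
qed simp

lemma row_insert_SomeI:
  assumes "k < length r" "x < r ! k" "\<forall>j<k. r ! j \<le> x"
  shows "row_insert x r = (Some (r ! k), r[k := x])"
  using assms
proof (induction r arbitrary: k)
  case (Cons z zs)
  show ?case
  proof (cases k)
    case (Suc l)
    have "row_insert x zs = (Some (zs ! l), zs[l := x])"
      by (rule Cons.IH) (use Cons.prems Suc in auto)
    moreover have "\<not> x < z" using Cons.prems Suc by auto
    ultimately show ?thesis using Suc by simp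
  qed (use Cons.prems in simp)
qed simp

text \<open>
  The effect of row insertion without distinguishing its two outcomes: position \<^term>\<open>k\<close> is
  overwritten, and \<open>k = length s\<close> means that \<^term>\<open>y\<close> is appended.
\<close>

definition place :: "nat \<Rightarrow> nat \<Rightarrow> nat list \<Rightarrow> nat list" where
  "place k y s = take k s @ y # drop (Suc k) s"

lemma nth_place_same: "k \<le> length s \<Longrightarrow> place k y s ! k = y"
  by (simp add: place_def nth_append min_def)

lemma nth_place_other: "k \<le> length s \<Longrightarrow> j \<noteq> k \<Longrightarrow> j < length s \<Longrightarrow> place k y s ! j = s ! j"
  unfolding place_def
  by (cases "j < k") (auto simp: nth_append nth_Cons' min_def not_less)

lemmas nth_place = nth_place_same nth_place_other

lemma length_place: "k \<le> length s \<Longrightarrow> length (place k y s) = max (Suc k) (length s)"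
  by (auto simp: place_def)

lemma place_eq_update: "k < length s \<Longrightarrow> place k y s = s[k := y]"
  by (simp add: place_def upd_conv_take_nth_drop)

lemma place_eq_append: "place (length s) y s = s @ [y]"
  by (simp add: place_def)

definition insert_position :: "nat \<Rightarrow> nat \<Rightarrow> nat list \<Rightarrow> bool" where
  "insert_position k y s \<longleftrightarrow> k \<le> length s \<and> (\<forall>j<k. s ! j < y) \<and> (\<forall>j. k \<le> j \<and> j < length s \<longrightarrow> y < s ! j)"

lemma sorted_wrt_place:
  assumes "sorted_wrt (<) s" and "insert_position k y s"
  shows "sorted_wrt (<) (place k y s)"
  unfolding sorted_wrt_iff_nth_less
proof (intro allI impI)
  fix i j assume "i < j" "j < length (place k y s)"
  with assms show "place k y s ! i < place k y s ! j"
    by (cases "i = k"; cases "j = k")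
      (auto simp: insert_position_def nth_place length_place sorted_wrt_iff_nth_less)
qed

text \<open>
  The entry ejected from position \<^term>\<open>k\<close> moves weakly to the left in the next row, because any
  entry below it was already larger. Hence it comes to lie below an entry that is not to the right of
  position \<^term>\<open>k\<close>, and all of those are smaller than it after the replacement.
\<close>

lemma row_above_bump:
  assumes above: "row_above r s" and r: "sorted_wrt (<) r"
    and k: "k < length r" "x < r ! k"
    and l: "insert_position l (r ! k) s"
  shows "row_above (r[k := x]) (place l (r ! k) s)"
proof -
  have "l \<le> k"
  proof (rule ccontr)
    assume "\<not> l \<le> k"
    then have "s ! k < r ! k" "k < length s" using l by (auto simp: insert_position_def)
    with above show False by (auto simp: row_above_def)
  qed
  show ?thesis
    unfolding row_above_def
  proof (intro conjI allI impI)
    show "length (place l (r ! k) s) \<le> length (r[k := x])"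
      using above l k \<open>l \<le> k\<close> by (auto simp: row_above_def length_place insert_position_def)
  next
    fix j assume j: "j < length (place l (r ! k) s)"
    show "r[k := x] ! j < place l (r ! k) s ! j"
    proof (cases "j = l")
      case True
      have "r ! l < r ! k" if "l \<noteq> k"
        using that \<open>l \<le> k\<close> k r by (auto simp: sorted_wrt_iff_nth_less)
      with True k l show ?thesis
        by (cases "l = k") (auto simp: nth_place insert_position_def)
    next
      case False
      then have "j < length s" using j l by (auto simp: length_place insert_position_def)
      then have "r ! j < s ! j" using above by (simp add: row_above_def)
      with False k l show ?thesis
        using \<open>j < length s\<close> by (cases "j = k") (auto simp: nth_place insert_position_def)
    qed
  qed
qed

text \<open>
  Reverse bumping preserves the columns for the mirrored reason: \<^term>\<open>y\<close> moves weakly to the right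
  on its way up, and in the lower row everything from its old position on exceeds it.
\<close>

lemma row_above_unbump:
  assumes above: "row_above r (place l y s)" and k: "k < length r" "\<forall>j. k < j \<and> j < length r \<longrightarrow> y < r ! j"
    and s: "sorted_wrt (<) s" and l: "insert_position l y s"
  shows "row_above (r[k := y]) s"
proof -
  have len: "length s \<le> length r" "l < length r"
    using above l by (auto simp: row_above_def length_place insert_position_def)
  have "r ! l < y"
    using above l len by (auto simp: row_above_def length_place nth_place insert_position_def
        dest!: spec[of _ l])
  then have "l \<le> k"
    using k(2) len(2) by (meson leI less_asym)
  show ?thesis
    unfolding row_above_def
  proof (intro conjI allI impI)
    show "length s \<le> length (r[k := y])" using len by simp
  next
    fix j assume j: "j < length s"
    have *: "r ! j < place l y s ! j"
      using above j l by (auto simp: row_above_def length_place insert_position_def)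
    show "r[k := y] ! j < s ! j"
    proof (cases "j = k")
      case True
      then show ?thesis using l j k \<open>l \<le> k\<close> by (auto simp: insert_position_def)
    next
      case False
      have "y < s ! j" if "j = l" using l j that by (auto simp: insert_position_def)
      with False * j l \<open>r ! l < y\<close> show ?thesis
        by (cases "j = l") (auto simp: nth_place insert_position_def)
    qed
  qed
qed

lemma row_insert_place:
  assumes "sorted_wrt (<) s" and "y \<notin> set s"
  obtains k where "insert_position k y s"
    "row_insert y s = (if k < length s then Some (s ! k) else None, place k y s)"
proof (cases "row_insert y s")
  case (Pair b s')
  show ?thesis
  proof (cases b)
    case None
    then have *: "s' = s @ [y]" "\<forall>z\<in>set s. z \<le> y"
      using Pair row_insert_None_iff by auto
    then have "insert_position (length s) y s"
      using assms(2) by (force simp: insert_position_def in_set_conv_nth le_less)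
    with Pair None * show ?thesis by (intro that) (auto simp: place_eq_append)
  next
    case (Some z)
    with Pair obtain k where k: "k < length s" "z = s ! k" "s' = s[k := y]" "y < z" "\<forall>j<k. s ! j \<le> y"
      using row_insert_SomeD by blast
    have "s ! j < y" if "j < k" for j
      using that k assms(2) by (metis le_neq_implies_less less_trans nth_mem)
    moreover have "y < s ! j" if "k \<le> j" "j < length s" for j
      using that k assms(1) by (metis le_neq_implies_less less_trans sorted_wrt_iff_nth_less)
    ultimately have "insert_position k y s"
      using k by (auto simp: insert_position_def)
    with Pair Some k show ?thesis by (intro that) (auto simp: place_eq_update)
  qed
qed

text \<open>
  In the inductions over the rows, only the first row of the lower part has to be compared with the
  row above it.
\<close>

lemma tableau_insert_first_row:
  assumes "increasing_tableau T" and "y \<notin> set (first_row T)"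
    and "tableau_insert y T = (T', i)"
  obtains k where "insert_position k y (first_row T)" "first_row T' = place k y (first_row T)"
proof (cases T)
  case Nil
  with assms that[of 0] show ?thesis by (auto simp: insert_position_def place_def)
next
  case (Cons r rs)
  have "sorted_wrt (<) r" "y \<notin> set r" using assms Cons by auto
  then obtain k where k: "insert_position k y r"
    "row_insert y r = (if k < length r then Some (r ! k) else None, place k y r)"
    by (rule row_insert_place)
  from k(2) assms(3) Cons have "first_row T' = place k y r"
    by (auto split: if_splits prod.splits)
  with k Cons show ?thesis by (intro that) auto
qed

lemma mset_tableau_insert:
  "tableau_insert x T = (T', i) \<Longrightarrow> mset (concat T') = add_mset x (mset (concat T))"
proof (induction T arbitrary: x T' i)
  case (Cons r rs)
  show ?case
  proof (cases "row_insert x r")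
    case (Pair b r')
    show ?thesis
    proof (cases b)
      case None
      with Pair Cons.prems have "r' = r @ [x]" "T' = r' # rs"
        by (auto dest: row_insert_None_iff[THEN iffD1])
      then show ?thesis by simp
    next
      case (Some y)
      with Pair Cons.prems obtain rs' i' where
        rs': "tableau_insert y rs = (rs', i')" "T' = r' # rs'"
        by (auto split: prod.splits)
      from Pair Some obtain k where "k < length r" "y = r ! k" "r' = r[k := x]"
        using row_insert_SomeD by blast
      then have "add_mset y (mset r') = add_mset x (mset r)"
        by (simp add: mset_update)
      then show ?thesis
        using Cons.IH[OF rs'(1)] rs'(2)
          by (metis concat.simps(2) mset_append union_mset_add_mset_left union_mset_add_mset_right)
    qed
  qed
qed auto

lemma tableau_shape_insert:
  "tableau_insert x T = (T', i) \<Longrightarrow> tableau_shape T' = add_box i (tableau_shape T)"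
proof (induction T arbitrary: x T' i)
  case Nil
  then show ?case by (auto simp: add_box_def tableau_shape_Cons fun_eq_iff split: nat.splits)
next
  case (Cons r rs)
  show ?case
  proof (cases "row_insert x r")
    case (Pair b r')
    show ?thesis
    proof (cases b)
      case None
      with Pair Cons.prems have "r' = r @ [x]" "T' = r' # rs" "i = 0"
        by (auto dest: row_insert_None_iff[THEN iffD1])
      then show ?thesis
        by (auto simp: add_box_def tableau_shape_Cons fun_eq_iff split: nat.splits)
    next
      case (Some y)
      with Pair Cons.prems obtain rs' i' where
        rs': "tableau_insert y rs = (rs', i')" "T' = r' # rs'" "i = Suc i'"
        by (auto split: prod.splits)
      from Pair Some have "length r' = length r"
        using row_insert_SomeD by fastforce
      with Cons.IH[OF rs'(1)] rs'(2,3) show ?thesis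
        by (auto simp: add_box_def tableau_shape_Cons fun_eq_iff split: nat.splits)
    qed
  qed
qed

lemma increasing_tableau_insert:
  assumes "increasing_tableau T" "distinct (concat T)" "x \<notin> set (concat T)"
    and "tableau_insert x T = (T', i)"
  shows "increasing_tableau T'"
  using assms
proof (induction T arbitrary: x T' i)
  case (Cons r rs)
  have r: "sorted_wrt (<) r" "x \<notin> set r" "r \<noteq> []" using Cons.prems by auto
  then obtain k where k: "insert_position k x r"
    "row_insert x r = (if k < length r then Some (r ! k) else None, place k x r)"
    by (elim row_insert_place)
  have ne: "place k x r \<noteq> []" by (simp add: place_def)
  have sorted: "sorted_wrt (<) (place k x r)"
    using r(1) k(1) by (rule sorted_wrt_place)
  show ?case
  proof (cases "k < length r")
    case True
    with k Cons.prems obtain rs' i' where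
      rs': "tableau_insert (r ! k) rs = (rs', i')" "T' = place k x r # rs'"
      by (auto split: prod.splits)
    have notin: "r ! k \<notin> set (concat rs)"
      using Cons.prems(2) True nth_mem by fastforce
    have inc: "increasing_tableau rs'"
      by (rule Cons.IH[OF _ _ notin rs'(1)]) (use Cons.prems in auto)
    have "r ! k \<notin> set (first_row rs)"
      using notin by (cases rs) auto
    then obtain l where l: "insert_position l (r ! k) (first_row rs)"
        "first_row rs' = place l (r ! k) (first_row rs)"
      using tableau_insert_first_row[OF _ _ rs'(1)] Cons.prems(1) by auto
    have "row_above (r[k := x]) (first_row rs')"
      unfolding l(2) by (rule row_above_bump)
        (use Cons.prems(1) True k(1) l(1) in \<open>auto simp: insert_position_def\<close>)
    then show ?thesis
      using rs' True ne sorted inc by (simp add: place_eq_update)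
  next
    case False
    then have "k = length r" using k(1) by (simp add: insert_position_def)
    then have "T' = (r @ [x]) # rs" using k Cons.prems by (auto simp: place_eq_append)
    moreover have "row_above (r @ [x]) (first_row rs)"
      using Cons.prems(1) by (auto simp: row_above_def nth_append)
    ultimately show ?thesis
      using Cons.prems(1) sorted \<open>k = length r\<close> by (simp add: place_eq_append)
  qed
qed auto

text \<open>
  The position of the bump can be read off from the new row: it is the last one whose entry is smaller
  than the ejected one.
\<close>

lemma row_unbump_unique:
  assumes "sorted_wrt (<) r1" "sorted_wrt (<) r2"
    and "row_insert x1 r1 = (Some y, r')" "row_insert x2 r2 = (Some y, r')"
  shows "x1 = x2 \<and> r1 = r2"
proof -
  obtain k1 where k1: "k1 < length r1" "y = r1 ! k1" "r' = r1[k1 := x1]" "x1 < y"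
    using row_insert_SomeD[OF assms(3)] by blast
  obtain k2 where k2: "k2 < length r2" "y = r2 ! k2" "r' = r2[k2 := x2]" "x2 < y"
    using row_insert_SomeD[OF assms(4)] by blast
  have len: "length r1 = length r'" "length r2 = length r'"
    using k1(3) k2(3) by (metis length_list_update)+
  have *: "y < r' ! j" if "k1 < j" "j < length r'" for j
  proof -
    have "r1 ! k1 < r1 ! j" using assms(1) that len(1) by (simp add: sorted_wrt_iff_nth_less)
    with that k1(2,3) show ?thesis by simp
  qed
  have **: "y < r' ! j" if "k2 < j" "j < length r'" for j
  proof -
    have "r2 ! k2 < r2 ! j" using assms(2) that len(2) by (simp add: sorted_wrt_iff_nth_less)
    with that k2(2,3) show ?thesis by simp
  qed
  have "r' ! k1 < y" "r' ! k2 < y"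
    using k1(1,3,4) k2(1,3,4) by (metis nth_list_update_eq)+
  with * ** have "k1 = k2"
    using k1(1) k2(1) len by (metis less_asym linorder_neqE_nat)
  moreover have "r1 = r'[k1 := y]" "r2 = r'[k2 := y]"
    using k1(2,3) k2(2,3) by (metis list_update_id list_update_overwrite)+
  moreover have "x1 = r' ! k1" "x2 = r' ! k2"
    using k1(1,3) k2(1,3) by (metis nth_list_update_eq)+
  ultimately show ?thesis by simp
qed

text \<open>
  The row of the new box tells where the bumping stopped. From there the bumps are undone upwards, one
  row at a time, each step being forced by the previous lemma.
\<close>

lemma tableau_insert_unique:
  assumes "increasing_tableau T1" "increasing_tableau T2"
    and "tableau_insert x1 T1 = (T', i)" "tableau_insert x2 T2 = (T', i)"
  shows "x1 = x2 \<and> T1 = T2"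
  using assms
proof (induction T1 arbitrary: x1 x2 T2 T' i)
  case Nil
  then show ?case
    by (cases T2) (auto split: prod.splits option.splits simp: row_insert_None_iff)
next
  case (Cons r1 rs1)
  \<comment> \<open>Only insertion into the empty tableau results in a single box.\<close>
  have "T2 \<noteq> []"
    using Cons.prems by (auto split: prod.splits option.splits simp: row_insert_None_iff)
  then obtain r2 rs2 where T2: "T2 = r2 # rs2" by (cases T2) auto
  obtain b1 r1' where ri1: "row_insert x1 r1 = (b1, r1')" by fastforce
  obtain b2 r2' where ri2: "row_insert x2 r2 = (b2, r2')" by fastforce
  show ?case
  proof (cases i)
    case 0
    then have "b1 = None" "b2 = None" "r1' # rs1 = r2' # rs2"
      using Cons.prems ri1 ri2 T2 by (auto split: prod.splits option.splits)
    then show ?thesis using ri1 ri2 T2 by (auto simp: row_insert_None_iff)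
  next
    case (Suc i')
    then obtain y1 y2 rs' where y: "b1 = Some y1" "b2 = Some y2" "tableau_insert y1 rs1 = (rs', i')"
      "tableau_insert y2 rs2 = (rs', i')" "r1' = r2'"
      using Cons.prems ri1 ri2 T2 by (auto split: prod.splits option.splits)
    have "y1 = y2 \<and> rs1 = rs2"
      by (rule Cons.IH[OF _ _ y(3,4)]) (use Cons.prems T2 in auto)
    moreover from this have "x1 = x2 \<and> r1 = r2"
      using row_unbump_unique[of r1 r2 x1 y1 r1' x2] ri1 ri2 y Cons.prems T2 by auto
    ultimately show ?thesis using T2 by simp
  qed
qed

text \<open>
  Reverse bumping can be started from any corner box: removing the box leaves a tableau because the
  next row is shorter, and each row above accepts the entry coming from below in exchange for its
  last smaller entry.
\<close>

lemma tableau_insert_exists: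
  assumes "increasing_tableau T'" "distinct (concat T')"
    and "tableau_shape T' (Suc i) < tableau_shape T' i"
  shows "\<exists>x T. increasing_tableau T \<and> tableau_insert x T = (T', i)"
  using assms
proof (induction T' arbitrary: i)
  case (Cons r' rs')
  show ?case
  proof (cases i)
    case 0
    from Cons.prems obtain r x where r': "r' = r @ [x]" by (cases r' rule: rev_cases) auto
    have shape: "length (first_row rs') \<le> length r"
      using Cons.prems(3) 0 r' by (simp add: tableau_shape_0)
    show ?thesis
    proof (cases "r = []")
      case True
      with shape Cons.prems(1) have "rs' = []" by (cases rs') auto
      with True r' 0 show ?thesis by (auto intro!: exI[of _ x] exI[of _ "[]"])
    next
      case False
      have "row_above r (first_row rs')"
        using Cons.prems(1) shape r' by (auto simp: row_above_def nth_append split: if_splits)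
      moreover have "row_insert x r = (None, r')"
        using Cons.prems(1) r' by (auto simp: row_insert_None_iff sorted_wrt_append le_less)
      ultimately show ?thesis
        using Cons.prems(1) False r' 0
        by (intro exI[of _ x] exI[of _ "r # rs'"]) (auto simp: sorted_wrt_append)
    qed
  next
    case (Suc i')
    have rs': "increasing_tableau rs'" "distinct (concat rs')" "sorted_wrt (<) r'"
      "row_above r' (first_row rs')" "r' \<noteq> []"
      using Cons.prems by auto
    obtain y rs where y: "increasing_tableau rs" "tableau_insert y rs = (rs', i')"
      using Cons.IH[of i'] Cons.prems Suc by auto
    have mset: "mset (concat rs') = add_mset y (mset (concat rs))"
      using y(2) by (rule mset_tableau_insert)
    have "y \<in># mset (concat rs')" unfolding mset by simp
    then have y_in: "y \<in> set (concat rs')" by (simp only: set_mset_mset)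
    then have "y \<notin> set r'" using Cons.prems(2) by auto
    have "mset (y # concat rs) = mset (concat rs')" using mset by simp
    then have "distinct (y # concat rs)"
      using rs'(2) by (metis mset_eq_imp_distinct_iff)
    then have "y \<notin> set (first_row rs)" by (cases rs) auto
    then obtain l where l: "insert_position l y (first_row rs)"
        "first_row rs' = place l y (first_row rs)"
      using tableau_insert_first_row[OF y(1) _ y(2)] by blast
    have "increasing_tableau (r' # rs')" "y \<in> set (concat (r' # rs'))"
      using Cons.prems(1) y_in by auto
    from increasing_tableau_bounded_below[OF this] obtain j where j: "j < length r'" "r' ! j \<le> y"
      by (auto simp: in_set_conv_nth)
    \<comment> \<open>Bumping ejected \<open>y\<close> from the last position that now carries a smaller entry.\<close>
    define k where "k = (GREATEST k. k < length r' \<and> r' ! k < y)"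
    have ex: "j < length r' \<and> r' ! j < y"
      using j \<open>y \<notin> set r'\<close> by (metis le_neq_implies_less nth_mem)
    have bound: "m \<le> length r'" if "m < length r' \<and> r' ! m < y" for m using that by simp
    have k: "k < length r'" "r' ! k < y"
      using GreatestI_nat[of "\<lambda>k. k < length r' \<and> r' ! k < y", OF ex bound] k_def by auto
    have max: "y < r' ! m" if "k < m" "m < length r'" for m
    proof (rule ccontr)
      assume "\<not> y < r' ! m"
      then have "m < length r' \<and> r' ! m < y"
        using that \<open>y \<notin> set r'\<close> by (metis linorder_neqE_nat nth_mem)
      then have "m \<le> k" unfolding k_def by (rule Greatest_le_nat[OF _ bound])
      with that show False by simp
    qed
    let ?r = "r'[k := y]"
    have "row_insert (r' ! k) ?r = (Some (?r ! k), ?r[k := r' ! k])"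
      by (rule row_insert_SomeI)
        (use k rs'(3) in \<open>auto simp: sorted_wrt_iff_nth_less less_imp_le\<close>)
    then have ins: "row_insert (r' ! k) ?r = (Some y, r')" using k by simp
    have "row_above ?r (first_row rs)"
      by (rule row_above_unbump[of _ l])
        (use rs'(4) l k max increasing_tableau_first_row[OF y(1)] in auto)
    moreover have "sorted_wrt (<) ?r"
      unfolding sorted_wrt_iff_nth_less
    proof (intro allI impI)
      fix a b assume ab: "a < b" "b < length ?r"
      then have "r' ! a < r' ! b" using rs'(3) by (auto simp: sorted_wrt_iff_nth_less)
      moreover have "r' ! a < y" if "b = k" using that calculation k by simp
      ultimately show "?r ! a < ?r ! b"
        using ab max k by (auto simp: nth_list_update)
    qed
    ultimately have "increasing_tableau (?r # rs)"
      using y(1) rs'(5) by simp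
    moreover have "tableau_insert (r' ! k) (?r # rs) = (r' # rs', i)"
      using ins y(2) Suc by simp
    ultimately show ?thesis by blast
  qed
qed simp
section \<open>Appending the largest entry\<close>

lemma append_to_row_Cons [simp]:
  "append_to_row 0 k (r # rs) = (r @ [k]) # rs"
  "append_to_row (Suc i) k (r # rs) = r # append_to_row i k rs"
  by (auto simp: append_to_row_def)

lemma append_to_row_Nil [simp]: "append_to_row i k [] = [[k]]"
  by (simp add: append_to_row_def)

lemma addable_tableau_shape_Cons [simp]:
  "addable (Suc i) (tableau_shape (r # rs)) \<longleftrightarrow>
     tableau_shape rs i < (if i = 0 then length r else tableau_shape rs (i - 1))"
  by (cases i) (auto simp: addable_def)

lemma addable_tableau_shape_tl:
  "addable (Suc i) (tableau_shape (r # rs)) \<Longrightarrow> addable i (tableau_shape rs)"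
  by (cases i) (auto simp: addable_def)

lemma mset_append_to_row: "mset (concat (append_to_row i k Q)) = add_mset k (mset (concat Q))"
proof (induction Q arbitrary: i)
  case (Cons r rs)
  then show ?case by (cases i) auto
qed simp

lemma tableau_shape_append_to_row:
  "addable i (tableau_shape Q) \<Longrightarrow> tableau_shape (append_to_row i k Q) = add_box i (tableau_shape Q)"
proof (induction Q arbitrary: i)
  case Nil
  then show ?case
    by (cases i) (auto simp: add_box_def addable_def tableau_shape_Cons fun_eq_iff split: nat.splits)
next
  case (Cons r rs)
  show ?case
  proof (cases i)
    case 0
    then show ?thesis
      by (auto simp: add_box_def tableau_shape_Cons fun_eq_iff split: nat.splits)
  next
    case (Suc i')
    have "addable i' (tableau_shape rs)"
      using Cons.prems Suc by (auto dest: addable_tableau_shape_tl simp del: addable_tableau_shape_Cons)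
    from Cons.IH[OF this] Suc show ?thesis
      by (auto simp: add_box_def tableau_shape_Cons fun_eq_iff split: nat.splits)
  qed
qed

lemma increasing_tableau_append_to_row:
  assumes "increasing_tableau Q" "addable i (tableau_shape Q)" "\<forall>q\<in>set (concat Q). q < k"
  shows "increasing_tableau (append_to_row i k Q)"
  using assms
proof (induction Q arbitrary: i)
  case (Cons r rs)
  show ?case
  proof (cases i)
    case 0
    have "row_above (r @ [k]) (first_row rs)"
      using Cons.prems(1) by (auto simp: row_above_def nth_append)
    with 0 Cons.prems show ?thesis by (auto simp: sorted_wrt_append)
  next
    case (Suc i')
    have i': "addable i' (tableau_shape rs)"
      using Cons.prems(2) Suc by (auto dest: addable_tableau_shape_tl simp del: addable_tableau_shape_Cons)
    have inc: "increasing_tableau (append_to_row i' k rs)"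
      by (rule Cons.IH) (use Cons.prems i' in auto)
    have "row_above r (first_row (append_to_row i' k rs))"
    proof (cases i')
      case 0
      then have "first_row (append_to_row i' k rs) = first_row rs @ [k]" by (cases rs) auto
      moreover have "length (first_row rs) < length r"
        using Cons.prems(2) Suc 0 by (simp add: tableau_shape_0)
      ultimately show ?thesis
        using Cons.prems by (auto simp: row_above_def nth_append)
    next
      case (Suc i'')
      with i' have "rs \<noteq> []" by (auto simp: addable_def)
      with Suc have "first_row (append_to_row i' k rs) = first_row rs" by (cases rs) auto
      with Cons.prems(1) show ?thesis by simp
    qed
    with inc Suc Cons.prems(1) show ?thesis by simp
  qed
qed simp

text \<open>
  The row of the entry is not a parameter. So this is a left inverse of appending the entry to a row,
  for all rows at once, and the row can afterwards be recovered by comparing shapes.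
\<close>

definition remove_entry :: "nat \<Rightarrow> tableau \<Rightarrow> tableau" where
  "remove_entry k T = filter (\<lambda>r. r \<noteq> []) (map (filter (\<lambda>x. x \<noteq> k)) T)"

lemma remove_entry_absent: "k \<notin> set (concat T) \<Longrightarrow> [] \<notin> set T \<Longrightarrow> remove_entry k T = T"
proof (induction T)
  case (Cons r rs)
  then have "filter (\<lambda>x. x \<noteq> k) r = r" by (auto intro!: filter_True)
  with Cons show ?case by (auto simp: remove_entry_def)
qed (simp add: remove_entry_def)

lemma remove_entry_append_to_row:
  "k \<notin> set (concat Q) \<Longrightarrow> [] \<notin> set Q \<Longrightarrow> remove_entry k (append_to_row i k Q) = Q"
proof (induction Q arbitrary: i)
  case (Cons r rs)
  then have *: "filter (\<lambda>x. x \<noteq> k) r = r" by (auto intro!: filter_True)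
  show ?case
  proof (cases i)
    case 0
    have "remove_entry k rs = rs" by (rule remove_entry_absent) (use Cons.prems in auto)
    with 0 * Cons.prems show ?thesis by (auto simp: remove_entry_def)
  next
    case (Suc i')
    have "remove_entry k (append_to_row i' k rs) = rs" by (rule Cons.IH) (use Cons.prems in auto)
    with Suc * Cons.prems show ?thesis by (auto simp: remove_entry_def)
  qed
qed (simp add: remove_entry_def)

lemma increasing_tableau_no_empty_row: "increasing_tableau T \<Longrightarrow> [] \<notin> set T"
  by (simp add: increasing_tableau_def)

text \<open>
  The largest entry is last in its row and has nothing below it, so it occupies a corner.
\<close>

lemma increasing_tableau_remove_max:
  assumes "increasing_tableau T" "distinct (concat T)" "m \<in> set (concat T)"
    and "\<forall>q\<in>set (concat T). q \<le> m"
  shows "\<exists>i Q. increasing_tableau Q \<and> addable i (tableau_shape Q) \<and> T = append_to_row i m Q"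
  using assms
proof (induction T)
  case (Cons r rs)
  show ?case
  proof (cases "m \<in> set r")
    case True
    obtain a z where r: "r = a @ [z]" using True by (cases r rule: rev_cases) auto
    have "z = m"
    proof (rule ccontr)
      assume "z \<noteq> m"
      with True r have "m \<in> set a" by auto
      then have "m < z" using Cons.prems(1) r by (auto simp: sorted_wrt_append)
      with Cons.prems(4) r show False by auto
    qed
    have short: "length (first_row rs) \<le> length a"
    proof (rule ccontr)
      assume "\<not> length (first_row rs) \<le> length a"
      then have "length a < length (first_row rs)" by simp
      then have "r ! length a < first_row rs ! length a" "first_row rs ! length a \<in> set (concat rs)"
        using Cons.prems(1) by (auto simp: row_above_def) (cases rs, auto)
      moreover from this(2) have "first_row rs ! length a \<le> m"
        using Cons.prems(4) by simp
      ultimately show False using r \<open>z = m\<close> by simp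
    qed
    show ?thesis
    proof (cases "a = []")
      case True
      with short Cons.prems(1) have "rs = []" by (cases rs) auto
      with r True \<open>z = m\<close> show ?thesis by (auto intro!: exI[of _ 0] exI[of _ "[]"] simp: addable_def)
    next
      case False
      have "row_above a (first_row rs)"
        using Cons.prems(1) short r by (auto simp: row_above_def nth_append split: if_splits)
      then show ?thesis
        using False Cons.prems(1) r \<open>z = m\<close>
        by (intro exI[of _ 0] exI[of _ "a # rs"]) (auto simp: sorted_wrt_append addable_def)
    qed
  next
    case False
    with Cons obtain i Q where Q: "increasing_tableau Q" "addable i (tableau_shape Q)"
      "rs = append_to_row i m Q" by auto
    have above: "row_above r (first_row Q) \<and> addable (Suc i) (tableau_shape (r # Q))"
    proof (cases i)
      case 0
      then have "first_row rs = first_row Q @ [m]" using Q(3) by (cases Q) auto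
      with Cons.prems(1) 0 show ?thesis
        by (auto simp: row_above_def nth_append tableau_shape_0 split: if_splits)
    next
      case (Suc i')
      with Q have "Q \<noteq> []" by (auto simp: addable_def)
      with Suc Q(3) have "first_row rs = first_row Q" by (cases Q) auto
      with Cons.prems(1) Q(2) Suc show ?thesis by (auto simp: addable_def)
    qed
    then show ?thesis
      using Q Cons.prems(1) by (intro exI[of _ "Suc i"] exI[of _ "r # Q"]) auto
  qed
qed simp

section \<open>The Robinson--Schensted correspondence is bijective\<close>

lemma robinson_schensted_Nil [simp]: "robinson_schensted [] = ([], [])"
  by (simp add: robinson_schensted_def)

lemma robinson_schensted_snoc:
  "robinson_schensted (w @ [x]) = rs_step (Suc (length w), x) (robinson_schensted w)"
  by (simp add: robinson_schensted_def enumerate_append_eq)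

lemma rs_stepE:
  assumes "rs_step (k, x) (P, Q) = (P', Q')"
  obtains i where "tableau_insert x P = (P', i)" "Q' = append_to_row i k Q"
  using assms by (auto simp: rs_step_def split: prod.splits)

lemma content_upTo: "mset (concat Q) = mset [1..<Suc l] \<longleftrightarrow> distinct (concat Q) \<and> set (concat Q) = {1..l}"
proof -
  have upt: "distinct [1..<Suc l]" "set [1..<Suc l] = {1..l}"
    by (simp_all only: distinct_upt set_upt atLeastLessThanSuc_atLeastAtMost)
  show ?thesis
    using set_eq_iff_mset_eq_distinct[of "concat Q" "[1..<Suc l]"] upt
      mset_eq_imp_distinct_iff[of "concat Q" "[1..<Suc l]"] by metis
qed

text \<open>
  Both tableaux grow by the same box in every step: the insertion tableau by bumping, the recording
  tableau by an entry larger than all previous ones. Since the shape of the insertion tableau stays a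
  partition, the row in which the box is recorded is one where a box can be added.
\<close>

lemma robinson_schensted_tableaux:
  assumes "distinct w" "robinson_schensted w = (P, Q)"
  shows "increasing_tableau P \<and> mset (concat P) = mset w \<and> increasing_tableau Q \<and>
    mset (concat Q) = mset [1..<Suc (length w)] \<and> tableau_shape P = tableau_shape Q"
  using assms
proof (induction w arbitrary: P Q rule: rev_induct)
  case (snoc x w P' Q')
  obtain P Q where PQ: "robinson_schensted w = (P, Q)" by fastforce
  then obtain i where i: "tableau_insert x P = (P', i)" "Q' = append_to_row i (Suc (length w)) Q"
    using snoc.prems by (auto simp: robinson_schensted_snoc elim: rs_stepE)
  have IH: "increasing_tableau P" "mset (concat P) = mset w" "increasing_tableau Q"
    "mset (concat Q) = mset [1..<Suc (length w)]" "tableau_shape P = tableau_shape Q"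
    using snoc.IH[OF _ PQ] snoc.prems by auto
  have P: "distinct (concat P)" "set (concat P) = set w"
    using mset_eq_imp_distinct_iff[OF IH(2)] mset_eq_setD[OF IH(2)] snoc.prems(1)
    by (auto simp del: set_concat)
  have inc: "increasing_tableau P'"
    by (rule increasing_tableau_insert[OF IH(1) P(1) _ i(1)]) (use snoc.prems(1) P(2) in auto)
  have shape: "tableau_shape P' = add_box i (tableau_shape Q)"
    using tableau_shape_insert[OF i(1)] IH(5) by simp
  then have add: "addable i (tableau_shape Q)"
    using add_box_in_int_partitions_iff increasing_tableau_shape inc IH(3) by metis
  have "increasing_tableau Q'"
    unfolding i(2)
    by (rule increasing_tableau_append_to_row[OF IH(3) add])
      (use IH(4)[unfolded content_upTo] in \<open>auto simp del: set_concat\<close>)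
  then show ?case
    using inc shape mset_tableau_insert[OF i(1)] IH(2,4)
    by (auto simp: i(2) mset_append_to_row tableau_shape_append_to_row[OF add])
qed simp

text \<open>
  The word is recovered from its end. The largest entry of the recording tableau marks the box created
  last, and reverse bumping from this box yields the last letter and the previous insertion tableau.
\<close>

lemma robinson_schensted_inj:
  assumes "distinct w1" "distinct w2" "length w1 = length w2"
    and "robinson_schensted w1 = robinson_schensted w2"
  shows "w1 = w2"
  using assms(3,1,2,4)
proof (induction w1 w2 rule: rev_induct2)
  case (4 x xs y ys)
  obtain P1 Q1 where PQ1: "robinson_schensted xs = (P1, Q1)" by fastforce
  obtain P2 Q2 where PQ2: "robinson_schensted ys = (P2, Q2)" by fastforce
  obtain P' Q' where PQ: "robinson_schensted (xs @ [x]) = (P', Q')" by fastforce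
  let ?k = "Suc (length xs)"
  have len: "length ys = length xs" using 4 by simp
  from PQ PQ1 obtain i1 where i1: "tableau_insert x P1 = (P', i1)" "Q' = append_to_row i1 ?k Q1"
    by (auto simp: robinson_schensted_snoc elim: rs_stepE)
  have "robinson_schensted (ys @ [y]) = (P', Q')" using PQ 4 by simp
  with PQ2 len obtain i2 where i2: "tableau_insert y P2 = (P', i2)" "Q' = append_to_row i2 ?k Q2"
    by (auto simp: robinson_schensted_snoc elim: rs_stepE)
  have 1: "increasing_tableau P1" "increasing_tableau Q1" "?k \<notin> set (concat Q1)"
      "tableau_shape P1 = tableau_shape Q1"
    using robinson_schensted_tableaux[OF _ PQ1] 4(3) content_upTo by (auto simp del: set_concat)
  have 2: "increasing_tableau P2" "increasing_tableau Q2" "?k \<notin> set (concat Q2)"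
      "tableau_shape P2 = tableau_shape Q2"
    using robinson_schensted_tableaux[OF _ PQ2] 4(4) content_upTo len by (auto simp del: set_concat)
  have "Q1 = Q2"
    using remove_entry_append_to_row[OF 1(3) increasing_tableau_no_empty_row[OF 1(2)], of i1]
      remove_entry_append_to_row[OF 2(3) increasing_tableau_no_empty_row[OF 2(2)], of i2] i1(2) i2(2)
    by simp
  then have "i1 = i2"
    using tableau_shape_insert[OF i1(1)] tableau_shape_insert[OF i2(1)] 1(4) 2(4) by simp
  then have "x = y \<and> P1 = P2"
    using tableau_insert_unique[OF 1(1) 2(1)] i1 i2 by simp
  moreover have "xs = ys"
    by (rule 4(1)) (use 4(3,4) len PQ1 PQ2 \<open>Q1 = Q2\<close> calculation in auto)
  ultimately show ?case by simp
qed auto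

text \<open>
  The recovery procedure never gets stuck, because the largest entry of any standard recording tableau
  sits in a corner. The content of \<^term>\<open>P\<close> is arbitrary here, as the letters that remain
  after some have been removed need not form an initial segment.
\<close>

lemma robinson_schensted_surj:
  assumes "increasing_tableau P" "distinct (concat P)" "increasing_tableau Q"
    and "distinct (concat Q)" "set (concat Q) = {1..l}" "tableau_shape P = tableau_shape Q"
  shows "\<exists>w. distinct w \<and> mset w = mset (concat P) \<and> robinson_schensted w = (P, Q)"
  using assms
proof (induction l arbitrary: P Q)
  case 0
  then have "concat Q = []" by (metis atLeastatMost_empty_iff2 not_one_le_zero set_empty)
  then have "concat P = []"
    using 0(6) partition_size_tableau_shape by (metis length_0_conv)
  with \<open>concat Q = []\<close> have "P = []" "Q = []"
    using 0(1,3)[THEN increasing_tableau_no_empty_row] by (cases P; cases Q; auto)+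
  then show ?case by (intro exI[of _ "[]"]) simp
next
  case (Suc l P' Q')
  have "\<forall>q\<in>set (concat Q'). q \<le> Suc l" "Suc l \<in> set (concat Q')"
    using Suc.prems(5) by (auto simp del: set_concat)
  then obtain i Q where Q: "increasing_tableau Q" "addable i (tableau_shape Q)"
      "Q' = append_to_row i (Suc l) Q"
    using increasing_tableau_remove_max Suc.prems(3,4) by blast
  have "add_mset (Suc l) (mset (concat Q)) = mset [1..<Suc (Suc l)]"
    using Suc.prems(4,5) content_upTo Q(3) mset_append_to_row by metis
  then have "mset (concat Q) = mset [1..<Suc l]" by simp
  then have contQ: "distinct (concat Q)" "set (concat Q) = {1..l}"
    using content_upTo by auto
  have shape: "tableau_shape P' = add_box i (tableau_shape Q)"
    using Suc.prems(6) Q tableau_shape_append_to_row by simp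
  have "tableau_shape Q (Suc i) \<le> tableau_shape Q i"
    using int_partitions_Suc_le increasing_tableau_shape Q(1) by blast
  then have "tableau_shape P' (Suc i) < tableau_shape P' i"
    by (simp add: shape add_box_def)
  then obtain x P where P: "increasing_tableau P" "tableau_insert x P = (P', i)"
    using tableau_insert_exists Suc.prems(1,2) by blast
  have mP: "mset (concat P') = add_mset x (mset (concat P))"
    using P(2) by (rule mset_tableau_insert)
  then have "mset (concat P') = mset (x # concat P)" by simp
  then have dP: "distinct (x # concat P)"
    using Suc.prems(2) by (metis mset_eq_imp_distinct_iff)
  have "tableau_shape P = tableau_shape Q"
    using tableau_shape_insert[OF P(2)] shape by simp
  then obtain w where w: "distinct w" "mset w = mset (concat P)" "robinson_schensted w = (P, Q)"
    using Suc.IH[OF P(1) _ Q(1) contQ] dP by auto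
  have "length w = l"
    using robinson_schensted_tableaux[OF w(1,3)] contQ content_upTo
    by (metis length_upt mset_eq_length diff_Suc_1)
  have "set w = set (concat P)" using w(2) mset_eq_setD by blast
  then have "distinct (w @ [x])" using w(1) dP by auto
  moreover have "mset (w @ [x]) = mset (concat P')" using w(2) mP by simp
  moreover have "robinson_schensted (w @ [x]) = (P', Q')"
    using w(3) P(2) Q(3) \<open>length w = l\<close> by (simp add: robinson_schensted_snoc rs_step_def)
  ultimately show ?case by blast
qed
section \<open>Branching of tableaux\<close>

lemma content_add_mset:
  assumes "mset (concat T) = add_mset x (mset (concat Q))"
  shows "distinct (concat T) \<longleftrightarrow> distinct (concat Q) \<and> x \<notin> set (concat Q)"
    and "set (concat T) = insert x (set (concat Q))"
proof -
  from assms have *: "mset (concat T) = mset (x # concat Q)" by simp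
  show "distinct (concat T) \<longleftrightarrow> distinct (concat Q) \<and> x \<notin> set (concat Q)"
    using mset_eq_imp_distinct_iff[OF *] by auto
  show "set (concat T) = insert x (set (concat Q))"
    using mset_eq_setD[OF *] by simp
qed

text \<open>
  Deleting the largest entry is injective once the smaller shape is remembered, and the larger shape
  \<^term>\<open>\<mu>\<close> says where to put the entry back.
\<close>

lemma tableaux_remove_max_eqpoll:
  assumes \<mu>: "\<mu> \<in> int_partitions" and m: "m \<in> S" "\<forall>q\<in>S. q \<le> m"
  shows "tableaux_of_content \<mu> S \<approx>
    (SIGMA \<nu> : lower_covers \<mu>. tableaux_of_content \<nu> (S - {m}))"
proof -
  have remove: "\<exists>i Q. T = append_to_row i m Q \<and> remove_entry m T = Q \<and> \<mu> = add_box i (tableau_shape Q) \<and>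
      Q \<in> tableaux_of_content (tableau_shape Q) (S - {m})"
    if T: "T \<in> tableaux_of_content \<mu> S" for T
  proof -
    have T: "increasing_tableau T" "distinct (concat T)" "set (concat T) = S" "tableau_shape T = \<mu>"
      using T by (auto simp: tableaux_of_content_def simp del: set_concat)
    then obtain i Q where Q: "increasing_tableau Q" "addable i (tableau_shape Q)"
        "T = append_to_row i m Q"
      using increasing_tableau_remove_max m by blast
    have cont: "distinct (concat Q)" "m \<notin> set (concat Q)" "insert m (set (concat Q)) = S"
      using content_add_mset[OF mset_append_to_row, of i m Q] T(2,3) Q(3) by blast+
    then have "Q \<in> tableaux_of_content (tableau_shape Q) (S - {m})"
      using Q(1) by (auto simp: tableaux_of_content_def simp del: set_concat)
    moreover have "remove_entry m T = Q"
      unfolding Q(3) using cont(2) Q(1) increasing_tableau_no_empty_row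
      by (intro remove_entry_append_to_row) auto
    moreover have "\<mu> = add_box i (tableau_shape Q)"
      using T(4) Q(2,3) tableau_shape_append_to_row by metis
    ultimately show ?thesis using Q(3) by blast
  qed
  let ?f = "\<lambda>T. (tableau_shape (remove_entry m T), remove_entry m T)"
  have "bij_betw ?f (tableaux_of_content \<mu> S)
      (SIGMA \<nu> : lower_covers \<mu>. tableaux_of_content \<nu> (S - {m}))"
  proof (rule bij_betwI')
    fix T1 T2 assume T12: "T1 \<in> tableaux_of_content \<mu> S" "T2 \<in> tableaux_of_content \<mu> S"
    obtain i1 Q1 where
      "T1 = append_to_row i1 m Q1" "remove_entry m T1 = Q1" "\<mu> = add_box i1 (tableau_shape Q1)"
      using remove[OF T12(1)] by blast
    moreover obtain i2 Q2 where
      "T2 = append_to_row i2 m Q2" "remove_entry m T2 = Q2" "\<mu> = add_box i2 (tableau_shape Q2)"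
      using remove[OF T12(2)] by blast
    ultimately have "T1 = T2" if "remove_entry m T1 = remove_entry m T2"
      using that add_box_row_inj by metis
    then show "?f T1 = ?f T2 \<longleftrightarrow> T1 = T2" by blast
  next
    fix T assume T: "T \<in> tableaux_of_content \<mu> S"
    obtain i Q where Q: "remove_entry m T = Q" "\<mu> = add_box i (tableau_shape Q)"
      "Q \<in> tableaux_of_content (tableau_shape Q) (S - {m})"
      using remove[OF T] by blast
    moreover from Q(3) have "tableau_shape Q \<in> int_partitions"
      by (auto simp: tableaux_of_content_def increasing_tableau_shape)
    ultimately show "?f T \<in> (SIGMA \<nu> : lower_covers \<mu>. tableaux_of_content \<nu> (S - {m}))"
      by (auto simp: lower_covers_def)
  next
    fix z assume "z \<in> (SIGMA \<nu> : lower_covers \<mu>. tableaux_of_content \<nu> (S - {m}))"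
    then obtain Q i where z: "z = (tableau_shape Q, Q)" "\<mu> = add_box i (tableau_shape Q)"
        "tableau_shape Q \<in> int_partitions"
      and Q: "increasing_tableau Q" "distinct (concat Q)" "set (concat Q) = S - {m}"
      by (auto simp: tableaux_of_content_def lower_covers_def simp del: set_concat)
    have add: "addable i (tableau_shape Q)"
      using z \<mu> add_box_in_int_partitions_iff by blast
    have less: "\<forall>q\<in>set (concat Q). q < m" using Q(3) m by (auto simp del: set_concat simp: le_less)
    have "append_to_row i m Q \<in> tableaux_of_content \<mu> S"
      using increasing_tableau_append_to_row[OF Q(1) add less] tableau_shape_append_to_row[OF add]
        content_add_mset[OF mset_append_to_row, of i m Q] Q(2,3) z(2) m(1)
      by (auto simp: tableaux_of_content_def simp del: set_concat)
    moreover have "remove_entry m (append_to_row i m Q) = Q"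
      using Q increasing_tableau_no_empty_row by (intro remove_entry_append_to_row) auto
    ultimately show "\<exists>T\<in>tableaux_of_content \<mu> S. z = ?f T" using z(1) by (intro bexI) auto
  qed
  then show ?thesis unfolding eqpoll_def by blast
qed

text \<open>
  Row insertion as a branching rule in the upward direction: the shape of the result determines the
  row of the new box, and every box that may be added to \<^term>\<open>\<mu>\<close> is a corner of the larger
  shape, from which the insertion can be reversed.
\<close>

lemma tableaux_insert_eqpoll:
  assumes \<mu>: "\<mu> \<in> int_partitions"
  shows "(SIGMA x : S. tableaux_of_content \<mu> (S - {x})) \<approx>
    (SIGMA \<nu> : upper_covers \<mu>. tableaux_of_content \<nu> S)"
proof -
  let ?f = "\<lambda>(x, T). (tableau_shape (fst (tableau_insert x T)), fst (tableau_insert x T))"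
  have "bij_betw ?f (SIGMA x : S. tableaux_of_content \<mu> (S - {x}))
      (SIGMA \<nu> : upper_covers \<mu>. tableaux_of_content \<nu> S)"
  proof (rule bij_betwI')
    fix z1 z2
    assume "z1 \<in> (SIGMA x : S. tableaux_of_content \<mu> (S - {x}))"
      and "z2 \<in> (SIGMA x : S. tableaux_of_content \<mu> (S - {x}))"
    then obtain x1 T1 x2 T2 where z: "z1 = (x1, T1)" "z2 = (x2, T2)"
      and T: "increasing_tableau T1" "tableau_shape T1 = \<mu>" "increasing_tableau T2" "tableau_shape T2 = \<mu>"
      by (auto simp: tableaux_of_content_def)
    obtain T1' i1 where i1: "tableau_insert x1 T1 = (T1', i1)" by fastforce
    obtain T2' i2 where i2: "tableau_insert x2 T2 = (T2', i2)" by fastforce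
    have "z1 = z2" if "T1' = T2'"
    proof -
      from that have "i1 = i2"
        using tableau_shape_insert[OF i1] tableau_shape_insert[OF i2] T by simp
      with that show ?thesis using tableau_insert_unique[OF T(1,3)] i1 i2 z by simp
    qed
    then show "?f z1 = ?f z2 \<longleftrightarrow> z1 = z2" using z i1 i2 by auto
  next
    fix z assume "z \<in> (SIGMA x : S. tableaux_of_content \<mu> (S - {x}))"
    then obtain x T where z: "z = (x, T)" "x \<in> S"
      and T: "increasing_tableau T" "tableau_shape T = \<mu>" "distinct (concat T)" "set (concat T) = S - {x}"
      by (auto simp: tableaux_of_content_def simp del: set_concat)
    obtain T' i where i: "tableau_insert x T = (T', i)" by fastforce
    have "increasing_tableau T'"
      using T by (intro increasing_tableau_insert[OF _ _ _ i]) auto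
    then show "?f z \<in> (SIGMA \<nu> : upper_covers \<mu>. tableaux_of_content \<nu> S)"
      using z i T tableau_shape_insert[OF i] content_add_mset[OF mset_tableau_insert[OF i]]
        increasing_tableau_shape[of T']
      by (auto simp: tableaux_of_content_def upper_covers_def simp del: set_concat)
  next
    fix z assume "z \<in> (SIGMA \<nu> : upper_covers \<mu>. tableaux_of_content \<nu> S)"
    then obtain T' i where z: "z = (tableau_shape T', T')" "tableau_shape T' = add_box i \<mu>"
      and T': "increasing_tableau T'" "distinct (concat T')" "set (concat T') = S"
      by (auto simp: tableaux_of_content_def upper_covers_def simp del: set_concat)
    have "tableau_shape T' (Suc i) < tableau_shape T' i"
      using int_partitions_Suc_le[OF \<mu>, of i] by (simp add: z(2) add_box_def)
    then obtain x T where T: "increasing_tableau T" and i: "tableau_insert x T = (T', i)"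
      using tableau_insert_exists T' by blast
    have "tableau_shape T = \<mu>"
      using tableau_shape_insert[OF i] z(2) by simp
    then have "(x, T) \<in> (SIGMA x : S. tableaux_of_content \<mu> (S - {x}))"
      using T T' content_add_mset[OF mset_tableau_insert[OF i]]
      by (auto simp: tableaux_of_content_def simp del: set_concat)
    moreover have "z = ?f (x, T)" using z i by simp
    ultimately show "\<exists>y\<in>(SIGMA x : S. tableaux_of_content \<mu> (S - {x})). z = ?f y" by blast
  qed
  then show ?thesis unfolding eqpoll_def by blast
qed

text \<open>
  Ranks serve two purposes: they relabel a tableau to a standard one, and they are the letters of the
  word of a pair partition.
\<close>

definition rank :: "nat set \<Rightarrow> nat \<Rightarrow> nat" where
  "rank S x = card {c \<in> S. c \<le> x}"

lemma rank_strict_mono: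
  assumes "finite S"
  shows "strict_mono_on S (rank S)"
proof (rule strict_mono_onI)
  fix x y assume "x \<in> S" "y \<in> S" "x < y"
  then have "{c \<in> S. c \<le> x} \<subseteq> {c \<in> S. c \<le> y}" "y \<in> {c \<in> S. c \<le> y} - {c \<in> S. c \<le> x}"
    by auto
  then have "{c \<in> S. c \<le> x} \<subset> {c \<in> S. c \<le> y}" by blast
  then show "rank S x < rank S y"
    unfolding rank_def using assms by (intro psubset_card_mono) auto
qed

lemma rank_bij_betw:
  assumes "finite S"
  shows "bij_betw (rank S) S {1..card S}"
proof -
  have inj: "inj_on (rank S) S"
    using rank_strict_mono[OF assms] by (rule strict_mono_on_imp_inj_on)
  have "rank S x \<in> {1..card S}" if "x \<in> S" for x
  proof -
    have "{x} \<subseteq> {c \<in> S. c \<le> x}" using that by auto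
    then have "card {x} \<le> rank S x" unfolding rank_def using assms by (intro card_mono) auto
    moreover have "rank S x \<le> card S" unfolding rank_def using assms by (intro card_mono) auto
    ultimately show ?thesis by simp
  qed
  then have "rank S ` S = {1..card S}"
    using inj by (intro card_subset_eq) (auto simp: card_image)
  with inj show ?thesis by (simp add: bij_betw_def)
qed

lemma relabel_tableau:
  assumes f: "strict_mono_on S f" and T: "T \<in> tableaux_of_content \<mu> S"
  shows "map (map f) T \<in> tableaux_of_content \<mu> (f ` S)"
proof -
  have T: "increasing_tableau T" "tableau_shape T = \<mu>" "distinct (concat T)" "set (concat T) = S"
    using T by (auto simp: tableaux_of_content_def simp del: set_concat)
  have less: "f x < f y" if "x \<in> S" "y \<in> S" "x < y" for x y
    using f that by (rule strict_mono_onD)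
  have "increasing_tableau (map (map f) T)"
    using T(1) eq_refl[OF T(4)]
  proof (induction T)
    case (Cons r rs)
    have r: "set r \<subseteq> S" and rs: "set (concat rs) \<subseteq> S" using Cons.prems(2) by simp_all
    then have first: "set (first_row rs) \<subseteq> S" by (cases rs) simp_all
    have "sorted_wrt (<) (map f r)"
      unfolding sorted_wrt_iff_nth_less length_map
    proof (intro allI impI)
      fix i j assume ij: "i < j" "j < length r"
      then have "r ! i < r ! j" using Cons.prems(1) by (simp add: sorted_wrt_iff_nth_less)
      moreover have "r ! i \<in> S" "r ! j \<in> S" using ij r nth_mem[of _ r] by auto
      ultimately show "map f r ! i < map f r ! j" using ij less by simp
    qed
    moreover have "row_above (map f r) (map f (first_row rs))"
      unfolding row_above_def length_map
    proof (intro conjI allI impI)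
      show len: "length (first_row rs) \<le> length r" using Cons.prems(1) by (simp add: row_above_def)
      fix j assume j: "j < length (first_row rs)"
      then have "r ! j < first_row rs ! j" using Cons.prems(1) by (simp add: row_above_def)
      moreover have "r ! j \<in> S" "first_row rs ! j \<in> S"
        using j len r first nth_mem[of j r] nth_mem[of j "first_row rs"] by auto
      ultimately show "map f r ! j < map f (first_row rs) ! j" using j len less by simp
    qed
    moreover have "first_row (map (map f) rs) = map f (first_row rs)" by (cases rs) simp_all
    ultimately show ?case using Cons.IH Cons.prems(1) rs by simp
  qed simp
  moreover have "tableau_shape (map (map f) T) = \<mu>"
    unfolding T(2)[symmetric] by (auto simp: tableau_shape_def fun_eq_iff)
  moreover have "concat (map (map f) T) = map f (concat T)" by (simp add: map_concat)
  ultimately show ?thesis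
    using T(3,4) strict_mono_on_imp_inj_on[OF f]
    by (simp add: tableaux_of_content_def distinct_map del: set_concat)
qed

lemma relabel_tableaux_eqpoll:
  assumes f: "strict_mono_on S f"
  shows "tableaux_of_content \<mu> S \<approx> tableaux_of_content \<mu> (f ` S)"
proof -
  let ?g = "inv_into S f"
  have inj: "inj_on f S" using f by (rule strict_mono_on_imp_inj_on)
  have g: "strict_mono_on (f ` S) ?g"
  proof (rule strict_mono_onI)
    fix a b assume "a \<in> f ` S" "b \<in> f ` S" "a < b"
    then show "?g a < ?g b"
      using f inj by (auto simp: strict_mono_on_less)
  qed
  have img: "?g ` f ` S = S" using inj by force
  have inverse: "map (map h) (map (map k) T) = T"
    if "\<And>x. x \<in> set (concat T) \<Longrightarrow> h (k x) = x" for h k :: "nat \<Rightarrow> nat" and T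
    unfolding map_map o_def
  proof (intro map_idI)
    fix r x assume "r \<in> set T" "x \<in> set r"
    with that show "h (k x) = x" by auto
  qed
  have "bij_betw (map (map f)) (tableaux_of_content \<mu> S) (tableaux_of_content \<mu> (f ` S))"
  proof (rule bij_betw_byWitness[where f' = "map (map ?g)"])
    show "\<forall>T\<in>tableaux_of_content \<mu> S. map (map ?g) (map (map f) T) = T"
      using inj by (intro ballI inverse) (auto simp: tableaux_of_content_def simp del: set_concat)
    show "\<forall>T\<in>tableaux_of_content \<mu> (f ` S). map (map f) (map (map ?g) T) = T"
      by (intro ballI inverse) (auto simp: tableaux_of_content_def f_inv_into_f simp del: set_concat)
    show "map (map f) ` tableaux_of_content \<mu> S \<subseteq> tableaux_of_content \<mu> (f ` S)"
      using relabel_tableau[OF f] by blast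
    show "map (map ?g) ` tableaux_of_content \<mu> (f ` S) \<subseteq> tableaux_of_content \<mu> S"
      using relabel_tableau[OF g] img by auto
  qed
  then show ?thesis unfolding eqpoll_def by blast
qed

lemma standard_tableaux_down_eqpoll:
  assumes \<mu>: "\<mu> \<in> int_partitions" and size: "partition_size \<mu> = Suc l"
  shows "standard_tableaux \<mu> \<approx> (SIGMA \<nu> : lower_covers \<mu>. standard_tableaux \<nu>)"
proof -
  have "partition_size \<nu> = l" if "\<nu> \<in> lower_covers \<mu>" for \<nu>
    using that size by (auto simp: lower_covers_def partition_size_add_box)
  moreover have "{1..Suc l} - {Suc l} = {1..l}" by auto
  ultimately have "standard_tableaux \<nu> = tableaux_of_content \<nu> ({1..Suc l} - {Suc l})"
    if "\<nu> \<in> lower_covers \<mu>" for \<nu>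
    using that standard_tableaux_eq[of \<nu>] by (simp add: lower_covers_def)
  then have "(SIGMA \<nu> : lower_covers \<mu>. standard_tableaux \<nu>) =
      (SIGMA \<nu> : lower_covers \<mu>. tableaux_of_content \<nu> ({1..Suc l} - {Suc l}))"
    by (rule Sigma_cong[OF refl])
  moreover have "standard_tableaux \<mu> = tableaux_of_content \<mu> {1..Suc l}"
    using \<mu> size by (simp add: standard_tableaux_eq)
  ultimately show ?thesis
    using tableaux_remove_max_eqpoll[OF \<mu>, of "Suc l" "{1..Suc l}"] by simp
qed

text \<open>
  A letter \<^term>\<open>x\<close> and a standard tableau correspond to a tableau whose content omits \<^term>\<open>x\<close>;
  inserting \<^term>\<open>x\<close> there produces each standard tableau of each larger shape exactly once.
\<close>

lemma standard_tableaux_up_eqpoll: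
  assumes \<mu>: "\<mu> \<in> int_partitions"
  shows "{1..Suc (partition_size \<mu>)} \<times> standard_tableaux \<mu> \<approx>
    (SIGMA \<nu> : upper_covers \<mu>. standard_tableaux \<nu>)"
proof -
  let ?S = "{1..Suc (partition_size \<mu>)}"
  have "partition_size \<nu> = Suc (partition_size \<mu>)" if "\<nu> \<in> upper_covers \<mu>" for \<nu>
    using that \<mu> by (auto simp: upper_covers_def partition_size_add_box)
  then have "standard_tableaux \<nu> = tableaux_of_content \<nu> ?S" if "\<nu> \<in> upper_covers \<mu>" for \<nu>
    using that standard_tableaux_eq[of \<nu>] by (simp add: upper_covers_def)
  then have target: "(SIGMA \<nu> : upper_covers \<mu>. standard_tableaux \<nu>) =
      (SIGMA \<nu> : upper_covers \<mu>. tableaux_of_content \<nu> ?S)"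
    by (rule Sigma_cong[OF refl])
  have "standard_tableaux \<mu> \<approx> tableaux_of_content \<mu> (?S - {x})" if "x \<in> ?S" for x
  proof -
    let ?R = "?S - {x}"
    have "card ?R = partition_size \<mu>" using that by (subst card_Diff_singleton) simp_all
    then have "rank ?R ` ?R = {1..partition_size \<mu>}"
      using rank_bij_betw[of ?R] unfolding bij_betw_def by (metis finite_Diff finite_atLeastAtMost)
    then have "tableaux_of_content \<mu> ?R \<approx> standard_tableaux \<mu>"
      using relabel_tableaux_eqpoll[OF rank_strict_mono[of ?R], of \<mu>] standard_tableaux_eq[OF \<mu>]
      by (metis finite_Diff finite_atLeastAtMost)
    then show ?thesis by (rule eqpoll_sym)
  qed
  then have "?S \<times> standard_tableaux \<mu> \<approx> (SIGMA x : ?S. tableaux_of_content \<mu> (?S - {x}))"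
    by (rule Sigma_eqpoll_cong[of id, rotated]) simp_all
  also have "\<dots> \<approx> (SIGMA \<nu> : upper_covers \<mu>. tableaux_of_content \<nu> ?S)"
    using \<mu> by (rule tableaux_insert_eqpoll)
  finally show ?thesis unfolding target .
qed
section \<open>Half pair partitions\<close>

definition half_pair_partitions_with_singletons :: "nat \<Rightarrow> nat \<Rightarrow> nat set set set" where
  "half_pair_partitions_with_singletons n l = {\<sigma> \<in> half_pair_partitions n. card (propagating \<sigma>) = l}"

lemma partition_on_remove:
  assumes "partition_on A P" and "p \<in> P"
  shows "partition_on (A - p) (P - {p})"
proof -
  have "disjnt p (\<Union>(P - {p}))"
    using assms by (auto simp: partition_on_def disjnt_def disjoint_def)
  moreover have "insert p (P - {p}) = P" using assms(2) by auto
  ultimately show ?thesis using partition_on_insert assms(1) by metis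
qed

lemma partition_on_member_eq:
  "partition_on A P \<Longrightarrow> p \<in> P \<Longrightarrow> q \<in> P \<Longrightarrow> x \<in> p \<Longrightarrow> x \<in> q \<Longrightarrow> p = q"
  by (auto simp: partition_on_def disjoint_def)

lemma half_pair_partition_on: "\<sigma> \<in> half_pair_partitions n \<Longrightarrow> partition_on {1..n} \<sigma>"
  by (simp add: half_pair_partitions_def)

lemma half_pair_partition_bound: "\<sigma> \<in> half_pair_partitions n \<Longrightarrow> A \<in> \<sigma> \<Longrightarrow> x \<in> A \<Longrightarrow> x \<in> {1..n}"
  using partition_onD1[OF half_pair_partition_on] by blast

lemma propagating_subset: "\<sigma> \<in> half_pair_partitions n \<Longrightarrow> propagating \<sigma> \<subseteq> {1..n}"
  by (auto simp: half_pair_partitions_def propagating_def partition_on_def)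

lemma finite_propagating: "\<sigma> \<in> half_pair_partitions n \<Longrightarrow> finite (propagating \<sigma>)"
  using propagating_subset finite_subset by blast

lemma propagating_insert_singleton: "propagating (insert {m} \<sigma>) = insert m (propagating \<sigma>)"
  by (auto simp: propagating_def)

lemma propagating_remove_singleton: "propagating (\<sigma> - {{m}}) = propagating \<sigma> - {m}"
  by (auto simp: propagating_def)

lemma propagating_insert_pair: "a \<noteq> b \<Longrightarrow> propagating (insert {a, b} \<sigma>) = propagating \<sigma>"
  by (auto simp: propagating_def)

lemma propagating_remove_pair: "a \<noteq> b \<Longrightarrow> propagating (\<sigma> - {{a, b}}) = propagating \<sigma>"
  by (auto simp: propagating_def)

text \<open>
  The points that are not singletons come in pairs.
\<close>

lemma half_pair_partition_parity:
  assumes "\<sigma> \<in> half_pair_partitions n"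
  shows "even (int n - int (card (propagating \<sigma>)))"
proof -
  have part: "partition_on {1..n} \<sigma>" using assms by (rule half_pair_partition_on)
  then have fin: "finite \<sigma>" using finite_elements by blast
  have cards: "card A = 1 \<or> card A = 2" if "A \<in> \<sigma>" for A
    using assms that by (simp add: half_pair_partitions_def)
  have "n = card (\<Union>\<sigma>)" using partition_onD1[OF part] by (metis card_atLeastAtMost diff_Suc_1)
  also have "\<dots> = (\<Sum>A\<in>\<sigma>. card A)"
  proof (rule card_Union_disjoint)
    show "disjoint \<sigma>" using part by (rule partition_onD2)
    show "finite A" if "A \<in> \<sigma>" for A
      using cards[OF that] by (metis card.infinite zero_neq_numeral zero_neq_one)
  qed
  finally have "even n \<longleftrightarrow> even (card {A \<in> \<sigma>. odd (card A)})"
    using even_sum_iff[OF fin, of card] by simp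
  also have "{A \<in> \<sigma>. odd (card A)} = (\<lambda>i. {i}) ` propagating \<sigma>"
    using cards by (fastforce simp: propagating_def card_1_singleton_iff)
  also have "card \<dots> = card (propagating \<sigma>)" by (intro card_image) auto
  finally show ?thesis by simp
qed

lemma Y_br_eq:
  "Y_br n \<mu> = half_pair_partitions_with_singletons n (partition_size \<mu>) \<times> standard_tableaux \<mu>"
proof (cases "even (int n - int (partition_size \<mu>))")
  case False
  then have "card (propagating \<sigma>) \<noteq> partition_size \<mu>" if "\<sigma> \<in> half_pair_partitions n" for \<sigma>
    using half_pair_partition_parity[OF that] by metis
  then have "half_pair_partitions_with_singletons n (partition_size \<mu>) = {}"
    unfolding half_pair_partitions_with_singletons_def by blast
  with False show ?thesis unfolding Y_br_def by (simp only: if_False Sigma_empty1)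
qed (simp add: Y_br_def half_pair_partitions_with_singletons_def)

lemma half_pair_partitions_last_propagating_eqpoll:
  "{\<sigma> \<in> half_pair_partitions_with_singletons (Suc n) (Suc l). {Suc n} \<in> \<sigma>} \<approx>
     half_pair_partitions_with_singletons n l"
proof -
  have diff: "{1..Suc n} - {Suc n} = {1..n}" by auto
  let ?m = "{Suc n}"
  have "bij_betw (\<lambda>\<sigma>. \<sigma> - {?m})
      {\<sigma> \<in> half_pair_partitions_with_singletons (Suc n) (Suc l). ?m \<in> \<sigma>}
      (half_pair_partitions_with_singletons n l)"
  proof (rule bij_betw_byWitness[where f' = "insert ?m"])
    show "\<forall>\<sigma>\<in>{\<sigma> \<in> half_pair_partitions_with_singletons (Suc n) (Suc l). ?m \<in> \<sigma>}. insert ?m (\<sigma> - {?m}) = \<sigma>"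
      by auto
    have fresh: "?m \<notin> \<sigma>" if "\<sigma> \<in> half_pair_partitions n" for \<sigma>
      using half_pair_partition_bound[OF that, of ?m "Suc n"] by auto
    then show "\<forall>\<sigma>\<in>half_pair_partitions_with_singletons n l. insert ?m \<sigma> - {?m} = \<sigma>"
      by (auto simp: half_pair_partitions_with_singletons_def)
    show "(\<lambda>\<sigma>. \<sigma> - {?m}) ` {\<sigma> \<in> half_pair_partitions_with_singletons (Suc n) (Suc l). ?m \<in> \<sigma>}
        \<subseteq> half_pair_partitions_with_singletons n l"
    proof clarify
      fix \<sigma> assume \<sigma>: "\<sigma> \<in> half_pair_partitions_with_singletons (Suc n) (Suc l)" "?m \<in> \<sigma>"
      then have "partition_on {1..n} (\<sigma> - {?m})"
        using partition_on_remove[of "{1..Suc n}" \<sigma> ?m] diff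
        by (simp add: half_pair_partitions_with_singletons_def half_pair_partitions_def)
      moreover have "Suc n \<in> propagating \<sigma>" using \<sigma>(2) by (simp add: propagating_def)
      ultimately show "\<sigma> - {?m} \<in> half_pair_partitions_with_singletons n l"
        using \<sigma> by (auto simp: half_pair_partitions_with_singletons_def half_pair_partitions_def
            propagating_remove_singleton)
    qed
    show "insert ?m ` half_pair_partitions_with_singletons n l
        \<subseteq> {\<sigma> \<in> half_pair_partitions_with_singletons (Suc n) (Suc l). ?m \<in> \<sigma>}"
    proof clarify
      fix \<sigma> assume "\<sigma> \<in> half_pair_partitions_with_singletons n l"
      then have \<sigma>: "\<sigma> \<in> half_pair_partitions n" "card (propagating \<sigma>) = l"
        by (auto simp: half_pair_partitions_with_singletons_def)
      have "disjnt ?m (\<Union>\<sigma>)"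
        using half_pair_partition_on[OF \<sigma>(1)] by (auto simp: partition_on_def)
      then have "partition_on {1..Suc n} (insert ?m \<sigma>)"
        using half_pair_partition_on[OF \<sigma>(1)] diff by (simp add: partition_on_insert)
      moreover have "Suc n \<notin> propagating \<sigma>" using propagating_subset[OF \<sigma>(1)] by auto
      ultimately show "insert ?m \<sigma> \<in> half_pair_partitions_with_singletons (Suc n) (Suc l) \<and> ?m \<in> insert ?m \<sigma>"
        using \<sigma> finite_propagating[OF \<sigma>(1)]
        by (auto simp: half_pair_partitions_with_singletons_def half_pair_partitions_def
            propagating_insert_singleton)
    qed
  qed
  then show ?thesis unfolding eqpoll_def by blast
qed

text \<open>
  Cutting the pair of the last point and forgetting that point turns its partner into a singleton. To
  undo this one has to remember which singleton the partner was.
\<close>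

lemma half_pair_partitions_last_paired_eqpoll:
  "(SIGMA \<sigma> : half_pair_partitions_with_singletons n (Suc l). propagating \<sigma>) \<approx>
     {\<sigma> \<in> half_pair_partitions_with_singletons (Suc n) l. {Suc n} \<notin> \<sigma>}"
proof -
  let ?m = "Suc n"
  let ?f = "\<lambda>(\<sigma>, k). insert {k, ?m} (\<sigma> - {{k}})"
  have "bij_betw ?f (SIGMA \<sigma> : half_pair_partitions_with_singletons n (Suc l). propagating \<sigma>)
     {\<sigma> \<in> half_pair_partitions_with_singletons ?m l. {?m} \<notin> \<sigma>}"
  proof (rule bij_betwI')
    fix z1 z2
    assume "z1 \<in> (SIGMA \<sigma> : half_pair_partitions_with_singletons n (Suc l). propagating \<sigma>)"
      and "z2 \<in> (SIGMA \<sigma> : half_pair_partitions_with_singletons n (Suc l). propagating \<sigma>)"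
    then obtain \<sigma>1 k1 \<sigma>2 k2 where z: "z1 = (\<sigma>1, k1)" "z2 = (\<sigma>2, k2)"
      and hpp: "\<sigma>1 \<in> half_pair_partitions n" "\<sigma>2 \<in> half_pair_partitions n"
      and k: "{k1} \<in> \<sigma>1" "{k2} \<in> \<sigma>2"
      by (auto simp: half_pair_partitions_with_singletons_def propagating_def)
    have fresh: "?m \<notin> A" if "A \<in> \<sigma>1 \<or> A \<in> \<sigma>2" for A
      using that half_pair_partition_bound[OF hpp(1), of A ?m] half_pair_partition_bound[OF hpp(2), of A ?m]
      by auto
    have "z1 = z2" if eq: "?f z1 = ?f z2"
    proof -
      have "{k1, ?m} \<in> insert {k2, ?m} (\<sigma>2 - {{k2}})" using eq z by auto
      then have "{k1, ?m} = {k2, ?m}" using fresh[of "{k1, ?m}"] by auto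
      moreover have "k1 \<noteq> ?m" using fresh[of "{k1}"] k by auto
      ultimately have "k1 = k2" by (auto simp: doubleton_eq_iff)
      moreover have "{k1, ?m} \<notin> \<sigma>1 - {{k1}}" "{k2, ?m} \<notin> \<sigma>2 - {{k2}}" using fresh by auto
      ultimately have "\<sigma>1 - {{k1}} = \<sigma>2 - {{k1}}"
        using eq z Diff_insert_absorb by (metis (no_types, lifting) case_prod_conv)
      then show ?thesis using k z \<open>k1 = k2\<close> by auto
    qed
    then show "?f z1 = ?f z2 \<longleftrightarrow> z1 = z2" by blast
  next
    fix z assume "z \<in> (SIGMA \<sigma> : half_pair_partitions_with_singletons n (Suc l). propagating \<sigma>)"
    then obtain \<sigma> k where z: "z = (\<sigma>, k)" and \<sigma>: "\<sigma> \<in> half_pair_partitions n"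
      "card (propagating \<sigma>) = Suc l" and k: "{k} \<in> \<sigma>" "k \<in> propagating \<sigma>"
      by (auto simp: half_pair_partitions_with_singletons_def propagating_def)
    have part: "partition_on {1..n} \<sigma>" using \<sigma>(1) by (rule half_pair_partition_on)
    have kn: "k \<in> {1..n}" using propagating_subset[OF \<sigma>(1)] k(2) by blast
    have "partition_on ({1..n} - {k}) (\<sigma> - {{k}})"
      using part k(1) by (rule partition_on_remove)
    moreover from this have "disjnt {k, ?m} (\<Union>(\<sigma> - {{k}}))"
      by (auto simp: partition_on_def disjnt_def)
    moreover have "{1..?m} - {k, ?m} = {1..n} - {k}" by auto
    ultimately have "partition_on {1..?m} (?f z)"
      using kn z by (simp add: partition_on_insert)
    moreover have "card {k, ?m} = 2" using kn by simp
    moreover have "{?m} \<notin> ?f z"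
      using half_pair_partition_bound[OF \<sigma>(1), of "{?m}" ?m] kn z by auto
    moreover have "propagating (?f z) = propagating \<sigma> - {k}"
      using kn z by (simp add: propagating_insert_pair propagating_remove_singleton)
    ultimately show "?f z \<in> {\<sigma> \<in> half_pair_partitions_with_singletons ?m l. {?m} \<notin> \<sigma>}"
      using \<sigma> k(2) z by (auto simp: half_pair_partitions_with_singletons_def half_pair_partitions_def)
  next
    fix \<tau> assume "\<tau> \<in> {\<sigma> \<in> half_pair_partitions_with_singletons ?m l. {?m} \<notin> \<sigma>}"
    then have \<tau>: "\<tau> \<in> half_pair_partitions ?m" "card (propagating \<tau>) = l" "{?m} \<notin> \<tau>"
      by (auto simp: half_pair_partitions_with_singletons_def)
    have part: "partition_on {1..?m} \<tau>" using \<tau>(1) by (rule half_pair_partition_on)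
    then have "?m \<in> \<Union>\<tau>" by (auto simp: partition_on_def)
    then obtain A where A: "A \<in> \<tau>" "?m \<in> A" by blast
    moreover from A \<tau>(3) have "card A \<noteq> 1" by (auto simp: card_1_singleton_iff)
    ultimately have "card A = 2" using \<tau>(1) by (auto simp: half_pair_partitions_def)
    with A(2) obtain k where k: "A = {k, ?m}" "k \<noteq> ?m"
      by (auto simp: card_2_iff)
    let ?\<sigma> = "insert {k} (\<tau> - {{k, ?m}})"
    have kn: "k \<in> {1..n}" using half_pair_partition_bound[OF \<tau>(1) A(1), of k] k by auto
    have rest: "partition_on ({1..?m} - {k, ?m}) (\<tau> - {{k, ?m}})"
      using part A(1) k(1) by (blast intro: partition_on_remove)
    then have "k \<notin> \<Union>(\<tau> - {{k, ?m}})" by (auto simp: partition_on_def)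
    moreover have "{1..?m} - {k, ?m} = {1..n} - {k}" by auto
    ultimately have "partition_on {1..n} ?\<sigma>"
      using rest kn by (simp add: partition_on_insert)
    then have "?\<sigma> \<in> half_pair_partitions n"
      using \<tau>(1) by (auto simp: half_pair_partitions_def)
    moreover have "propagating ?\<sigma> = insert k (propagating \<tau>)"
      using k(2) by (simp add: propagating_insert_singleton propagating_remove_pair)
    moreover have kfresh: "{k} \<notin> \<tau>"
      using partition_on_member_eq[OF part A(1), of "{k}" k] k by auto
    then have "k \<notin> propagating \<tau>" by (simp add: propagating_def)
    ultimately have "(?\<sigma>, k) \<in> (SIGMA \<sigma> : half_pair_partitions_with_singletons n (Suc l). propagating \<sigma>)"
      using \<tau>(2) finite_propagating[OF \<tau>(1)] by (simp add: half_pair_partitions_with_singletons_def)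
    moreover have "\<tau> = ?f (?\<sigma>, k)" using A(1) k(1) kfresh by auto
    ultimately show "\<exists>z\<in>(SIGMA \<sigma> : half_pair_partitions_with_singletons n (Suc l). propagating \<sigma>). \<tau> = ?f z"
      by blast
  qed
  then show ?thesis unfolding eqpoll_def by blast
qed

section \<open>The Pascal array\<close>

text \<open>
  The edge maps into a vertex are the restrictions of a single bijection onto the set at that vertex,
  from the disjoint union of the sets at the initial vertices one level below.
\<close>

lemma pascal_arrayI:
  assumes G: "wf_digraph G" "v0 \<in> verts G"
    and root: "is_singleton (Y 0 v0)" "\<And>v. v \<in> verts G \<Longrightarrow> v \<noteq> v0 \<Longrightarrow> Y 0 v = {}"
    and step: "\<And>n v. v \<in> verts G \<Longrightarrow> (SIGMA e : in_arcs G v. Y n (tail G e)) \<approx> Y (Suc n) v"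
  shows "pascal_array G v0 Y"
proof -
  have "\<forall>n v. \<exists>F. v \<in> verts G \<longrightarrow> bij_betw F (SIGMA e : in_arcs G v. Y n (tail G e)) (Y (Suc n) v)"
    using step unfolding eqpoll_def by blast
  then obtain F where F: "\<And>n v. v \<in> verts G \<Longrightarrow>
      bij_betw (F n v) (SIGMA e : in_arcs G v. Y n (tail G e)) (Y (Suc n) v)"
    by metis
  define \<phi> where "\<phi> n e y = F (n - 1) (head G e) (e, y)" for n e y
  define good where "good n \<longleftrightarrow>
      (\<forall>e\<in>arcs G. \<phi> n e \<in> Y (n - 1) (tail G e) \<rightarrow> Y n (head G e) \<and>
                    inj_on (\<phi> n e) (Y (n - 1) (tail G e))) \<and>
      (\<forall>v\<in>verts G.
           Y n v = (\<Union>e\<in>in_arcs G v. \<phi> n e ` Y (n - 1) (tail G e)) \<and>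
           disjoint_family_on (\<lambda>e. \<phi> n e ` Y (n - 1) (tail G e)) (in_arcs G v))" for n
  have "good (Suc n)" for n
    unfolding good_def diff_Suc_1
  proof (intro conjI ballI)
    fix e assume e: "e \<in> arcs G"
    then have v: "head G e \<in> verts G" using G(1) by (simp add: wf_digraph.head_in_verts)
    from e show "\<phi> (Suc n) e \<in> Y n (tail G e) \<rightarrow> Y (Suc n) (head G e)"
      using bij_betwE[OF F[OF v]] by (auto simp: \<phi>_def)
    from e show "inj_on (\<phi> (Suc n) e) (Y n (tail G e))"
      using bij_betw_imp_inj_on[OF F[OF v]] by (auto simp: \<phi>_def inj_on_def)
  next
    fix v assume v: "v \<in> verts G"
    have "Y (Suc n) v = F n v ` (SIGMA e : in_arcs G v. Y n (tail G e))"
      using bij_betw_imp_surj_on[OF F[OF v]] by simp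
    also have "\<dots> = (\<Union>e\<in>in_arcs G v. \<phi> (Suc n) e ` Y n (tail G e))"
      by (auto simp: \<phi>_def image_iff Bex_def)
    finally show "Y (Suc n) v = (\<Union>e\<in>in_arcs G v. \<phi> (Suc n) e ` Y n (tail G e))" .
    show "disjoint_family_on (\<lambda>e. \<phi> (Suc n) e ` Y n (tail G e)) (in_arcs G v)"
      using bij_betw_imp_inj_on[OF F[OF v]]
      by (fastforce simp: disjoint_family_on_def \<phi>_def inj_on_def)
  qed
  then have "good n" if "n \<ge> 1" for n
    using that by (cases n) simp_all
  then show ?thesis
    unfolding pascal_array_def good_def using G root by blast
qed

lemma times_Sigma_eqpoll: "A \<times> Sigma B C \<approx> (SIGMA x : B. A \<times> C x)"
  unfolding eqpoll_def
  by (rule exI[of _ "\<lambda>(a, b, c). (b, a, c)"],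
      rule bij_betw_byWitness[where f' = "\<lambda>(b, a, c). (a, b, c)"]) auto

lemma Sigma_times_eqpoll:
  assumes "\<And>x. x \<in> A \<Longrightarrow> B x \<approx> C"
  shows "Sigma A B \<approx> A \<times> C"
  using assms by (intro Sigma_eqpoll_cong[of id]) auto

text \<open>
  If the last point is a singleton, it is removed together with the largest entry of the tableau,
  which takes a box away from the shape. If it is paired, the rank of its partner among the singletons
  of the smaller half pair partition is a number between \<open>1\<close> and \<open>|\<mu>| + 1\<close>, and inserting it into
  the tableau adds a box.
\<close>

lemma Y_br_step:
  assumes \<mu>: "\<mu> \<in> int_partitions"
  shows "Y_br (Suc n) \<mu> \<approx> (SIGMA \<nu> : lower_covers \<mu> \<union> upper_covers \<mu>. Y_br n \<nu>)"
proof -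
  let ?l = "partition_size \<mu>"
  let ?H = "half_pair_partitions_with_singletons"
  let ?A = "{\<sigma> \<in> ?H (Suc n) ?l. {Suc n} \<in> \<sigma>}"
  let ?B = "{\<sigma> \<in> ?H (Suc n) ?l. {Suc n} \<notin> \<sigma>}"
  have A: "?A \<times> standard_tableaux \<mu> \<approx> (SIGMA \<nu> : lower_covers \<mu>. Y_br n \<nu>)"
  proof (cases ?l)
    case 0
    have "{Suc n} \<notin> \<sigma>" if "\<sigma> \<in> ?H (Suc n) 0" for \<sigma>
    proof -
      have "propagating \<sigma> = {}"
        using that finite_propagating by (auto simp: half_pair_partitions_with_singletons_def)
      then show ?thesis by (auto simp: propagating_def)
    qed
    then have "?A = {}" using 0 by auto
    moreover have "lower_covers \<mu> = {}"
      using 0 partition_size_add_box by (auto simp: lower_covers_def)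
    ultimately show ?thesis by (simp only: Sigma_empty1 eqpoll_empty_iff_empty)
  next
    case (Suc l)
    have "?A \<approx> ?H n l" unfolding Suc by (rule half_pair_partitions_last_propagating_eqpoll)
    then have "?A \<times> standard_tableaux \<mu> \<approx> ?H n l \<times> (SIGMA \<nu> : lower_covers \<mu>. standard_tableaux \<nu>)"
      using standard_tableaux_down_eqpoll[OF \<mu> Suc] by (rule times_eqpoll_cong)
    also have "\<dots> \<approx> (SIGMA \<nu> : lower_covers \<mu>. ?H n l \<times> standard_tableaux \<nu>)"
      by (rule times_Sigma_eqpoll)
    also have "\<dots> = (SIGMA \<nu> : lower_covers \<mu>. Y_br n \<nu>)"
      using Suc by (intro Sigma_cong) (auto simp: Y_br_eq lower_covers_def partition_size_add_box)
    finally show ?thesis .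
  qed
  have "(SIGMA \<sigma> : ?H n (Suc ?l). propagating \<sigma>) \<approx> ?H n (Suc ?l) \<times> {1..Suc ?l}"
  proof (rule Sigma_times_eqpoll)
    fix \<sigma> assume "\<sigma> \<in> ?H n (Suc ?l)"
    then show "propagating \<sigma> \<approx> {1..Suc ?l}"
      using rank_bij_betw[of "propagating \<sigma>"] finite_propagating unfolding eqpoll_def
      by (auto simp: half_pair_partitions_with_singletons_def)
  qed
  then have "?B \<approx> ?H n (Suc ?l) \<times> {1..Suc ?l}"
    using half_pair_partitions_last_paired_eqpoll eqpoll_sym eqpoll_trans by blast
  then have "?B \<times> standard_tableaux \<mu> \<approx> (?H n (Suc ?l) \<times> {1..Suc ?l}) \<times> standard_tableaux \<mu>"
    using eqpoll_refl by (rule times_eqpoll_cong)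
  also have "\<dots> \<approx> ?H n (Suc ?l) \<times> ({1..Suc ?l} \<times> standard_tableaux \<mu>)"
    by (rule times_assoc_eqpoll)
  also have "\<dots> \<approx> ?H n (Suc ?l) \<times> (SIGMA \<nu> : upper_covers \<mu>. standard_tableaux \<nu>)"
    using eqpoll_refl standard_tableaux_up_eqpoll[OF \<mu>] by (rule times_eqpoll_cong)
  also have "\<dots> \<approx> (SIGMA \<nu> : upper_covers \<mu>. ?H n (Suc ?l) \<times> standard_tableaux \<nu>)"
    by (rule times_Sigma_eqpoll)
  also have "\<dots> = (SIGMA \<nu> : upper_covers \<mu>. Y_br n \<nu>)"
    using \<mu> by (intro Sigma_cong) (auto simp: Y_br_eq upper_covers_def partition_size_add_box)
  finally have B: "?B \<times> standard_tableaux \<mu> \<approx> (SIGMA \<nu> : upper_covers \<mu>. Y_br n \<nu>)" .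
  have "Y_br (Suc n) \<mu> = ?A \<times> standard_tableaux \<mu> \<union> ?B \<times> standard_tableaux \<mu>"
    unfolding Y_br_eq by blast
  moreover have "(SIGMA \<nu> : lower_covers \<mu> \<union> upper_covers \<mu>. Y_br n \<nu>) =
      (SIGMA \<nu> : lower_covers \<mu>. Y_br n \<nu>) \<union> (SIGMA \<nu> : upper_covers \<mu>. Y_br n \<nu>)"
    by blast
  moreover have "disjnt (?A \<times> standard_tableaux \<mu>) (?B \<times> standard_tableaux \<mu>)"
    by (auto simp: disjnt_def)
  moreover have "disjnt (SIGMA \<nu> : lower_covers \<mu>. Y_br n \<nu>) (SIGMA \<nu> : upper_covers \<mu>. Y_br n \<nu>)"
    using covers_disjoint[OF \<mu>] by (auto simp: disjnt_def)
  ultimately show ?thesis using Un_eqpoll_cong[OF A B] by simp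
qed

lemma standard_tableaux_zero: "standard_tableaux (\<lambda>_. 0) = {[]}"
proof -
  have "T = []" if "[] \<notin> set T" "tableau_shape T = (\<lambda>_. 0)" for T
  proof (rule ccontr)
    assume "T \<noteq> []"
    then have "tableau_shape T 0 \<noteq> 0" using that(1) by (cases T) auto
    with that(2) show False by simp
  qed
  then show ?thesis by (auto simp: standard_tableaux_def partition_size_def)
qed

lemma half_pair_partitions_0: "half_pair_partitions 0 = {{}}"
  by (auto simp: half_pair_partitions_def partition_on_empty)

lemma Y_br_pascal_array: "pascal_array young_graph (\<lambda>_. 0) Y_br"
proof (rule pascal_arrayI)
  show "wf_digraph young_graph"
    by unfold_locales (auto simp: young_graph_def)
  show "(\<lambda>_. 0) \<in> verts young_graph" by (simp add: young_graph_def zero_int_partition)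
  have rank0: "half_pair_partitions_with_singletons 0 l = (if l = 0 then {{}} else {})" for l
    by (auto simp: half_pair_partitions_with_singletons_def half_pair_partitions_0 propagating_def)
  show "is_singleton (Y_br 0 (\<lambda>_. 0))"
    by (simp add: Y_br_eq standard_tableaux_zero rank0 partition_size_def is_singleton_def)
  show "Y_br 0 \<mu> = {}" if "\<mu> \<in> verts young_graph" "\<mu> \<noteq> (\<lambda>_. 0)" for \<mu>
    using that by (simp add: Y_br_eq rank0 partition_size_eq_0_iff young_graph_def)
  show "(SIGMA e : in_arcs young_graph \<nu>. Y_br n (tail young_graph e)) \<approx> Y_br (Suc n) \<nu>"
    if "\<nu> \<in> verts young_graph" for n \<nu>
  proof -
    have \<nu>: "\<nu> \<in> int_partitions" using that by (simp add: young_graph_def)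
    have "in_arcs young_graph \<nu> = (\<lambda>\<mu>. (\<mu>, \<nu>)) ` {\<mu> \<in> int_partitions. young_adjacent \<mu> \<nu>}"
      using \<nu> by (auto simp: young_graph_def in_arcs_def)
    then have "bij_betw fst (in_arcs young_graph \<nu>) (lower_covers \<nu> \<union> upper_covers \<nu>)"
      unfolding young_neighbours[OF \<nu>]
      by (auto simp: bij_betw_def inj_on_def image_image)
    then have "(SIGMA e : in_arcs young_graph \<nu>. Y_br n (tail young_graph e)) \<approx>
        (SIGMA \<mu> : lower_covers \<nu> \<union> upper_covers \<nu>. Y_br n \<mu>)"
      by (rule Sigma_eqpoll_cong) (simp add: young_graph_def)
    then show ?thesis
      using Y_br_step[OF \<nu>] eqpoll_sym eqpoll_trans by blast
  qed
qed
section \<open>The bra-ket decomposition\<close>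

text \<open>
  A half pair partition is determined by its pairs. This is the form in which the half of a pair
  partition is given.
\<close>

lemma half_pair_partition_eq:
  assumes \<sigma>: "\<sigma> \<in> half_pair_partitions n"
  shows "\<sigma> = {A \<in> \<sigma>. card A = 2} \<union> {{i} | i. i \<in> {1..n} \<and> (\<forall>A\<in>\<sigma>. card A = 2 \<longrightarrow> i \<notin> A)}"
    (is "\<sigma> = ?pairs \<union> ?singles")
proof (intro equalityI subsetI)
  have part: "partition_on {1..n} \<sigma>" using \<sigma> by (rule half_pair_partition_on)
  have cards: "card A = 1 \<or> card A = 2" if "A \<in> \<sigma>" for A
    using \<sigma> that by (simp add: half_pair_partitions_def)
  fix A
  {
    assume A: "A \<in> \<sigma>"
    show "A \<in> ?pairs \<union> ?singles"
    proof (cases "card A = 2")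
      case False
      then obtain i where i: "A = {i}" using cards[OF A] by (auto simp: card_1_singleton_iff)
      have "i \<notin> B" if "B \<in> \<sigma>" "card B = 2" for B
      proof
        assume "i \<in> B"
        then have "A = B" using partition_on_member_eq[OF part A that(1), of i] i by blast
        with that(2) False show False by simp
      qed
      moreover have "i \<in> {1..n}" using half_pair_partition_bound[OF \<sigma> A] i by blast
      ultimately show ?thesis using i by blast
    qed (use A in blast)
  next
    assume "A \<in> ?pairs \<union> ?singles"
    then show "A \<in> \<sigma>"
    proof
      assume "A \<in> ?singles"
      then obtain i where i: "A = {i}" "i \<in> {1..n}" "\<forall>B\<in>\<sigma>. card B = 2 \<longrightarrow> i \<notin> B" by blast
      then obtain B where B: "B \<in> \<sigma>" "i \<in> B" using partition_onD1[OF part] by blast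
      with i cards have "card B = 1" by blast
      with B(2) have "B = {i}" by (auto simp: card_1_singleton_iff)
      with B i show ?thesis by simp
    qed blast
  }
qed

lemma half_of_eqI:
  assumes "\<sigma> \<in> half_pair_partitions n" and "\<And>A. emb ` A \<in> p \<longleftrightarrow> A \<in> \<sigma> \<and> card A = 2"
  shows "half_of n emb p = \<sigma>"
  by (subst half_pair_partition_eq[OF assms(1)]) (auto simp: half_of_def assms(2))

lemma C_br_partition: "p \<in> C_br n \<Longrightarrow> partition_on ({1..n} <+> {1..n}) p"
  and C_br_card: "p \<in> C_br n \<Longrightarrow> A \<in> p \<Longrightarrow> card A = 2"
  by (simp_all add: C_br_def)

text \<open>
  The two halves of a pair partition differ only by the embedding of their points.
\<close>

locale half_embedding =
  fixes n :: nat and emb :: "nat \<Rightarrow> nat + nat"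
  assumes inj: "inj emb" and points: "emb x \<in> {1..n} <+> {1..n} \<longleftrightarrow> x \<in> {1..n}"
begin

lemma card_image_eq: "card (emb ` A) = card A"
  using inj by (intro card_image) (auto simp: inj_on_def)

lemma propagating_half_of:
  assumes "p \<in> C_br n"
  shows "propagating (half_of n emb p) = {i \<in> {1..n}. \<forall>A. emb ` A \<in> p \<longrightarrow> i \<notin> A}"
proof -
  have "emb ` {i} \<notin> p" for i
    using C_br_card[OF assms, of "emb ` {i}"] by auto
  then show ?thesis by (auto simp: propagating_def half_of_def)
qed

lemma pair_in_half_of_iff: "card A = 2 \<Longrightarrow> A \<in> half_of n emb p \<longleftrightarrow> emb ` A \<in> p"
  by (auto simp: half_of_def)

lemma half_of_half_pair_partition:
  assumes p: "p \<in> C_br n"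
  shows "half_of n emb p \<in> half_pair_partitions n"
proof -
  have part: "partition_on ({1..n} <+> {1..n}) p" using p by (rule C_br_partition)
  have sub: "A \<subseteq> {1..n}" if "emb ` A \<in> p" for A
  proof
    fix x assume "x \<in> A"
    then have "emb x \<in> {1..n} <+> {1..n}" using that partition_onD1[OF part] by blast
    then show "x \<in> {1..n}" by (simp only: points)
  qed
  have cards: "card A = 1 \<or> card A = 2" if "A \<in> half_of n emb p" for A
    using that C_br_card[OF p, of "emb ` A"] by (auto simp: half_of_def card_image_eq)
  have "\<Union>(half_of n emb p) = {1..n}"
    using sub unfolding half_of_def by blast
  moreover have "{} \<notin> half_of n emb p"
    using cards by fastforce
  moreover have "A = B" if "A \<in> half_of n emb p" "B \<in> half_of n emb p" "x \<in> A" "x \<in> B" for A B x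
  proof -
    have "A = B" if "emb ` A \<in> p" "emb ` B \<in> p"
    proof -
      have "emb ` A = emb ` B"
        using partition_on_member_eq[OF part that, of "emb x"] \<open>x \<in> A\<close> \<open>x \<in> B\<close> by blast
      then show ?thesis using inj by (simp add: inj_image_eq_iff)
    qed
    with that show ?thesis unfolding half_of_def by blast
  qed
  then have "disjoint (half_of n emb p)" unfolding disjoint_def by blast
  ultimately show ?thesis
    using cards by (simp add: half_pair_partitions_def partition_on_def)
qed

end

interpretation bra: half_embedding n Inl for n
  by unfold_locales auto

interpretation ket: half_embedding n Inr for n
  by unfold_locales auto

lemma C_br_cases:
  assumes p: "p \<in> C_br n" and A: "A \<in> p"
  obtains (bra) B where "A = Inl ` B" "card B = 2"
  | (ket) B where "A = Inr ` B" "card B = 2"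
  | (through) a b where "A = {Inl a, Inr b}"
proof -
  obtain x y where xy: "A = {x, y}" "x \<noteq> y"
    using C_br_card[OF p A] by (auto simp: card_2_iff)
  show ?thesis
  proof (cases x; cases y)
    fix a b assume "x = Inl a" "y = Inl b"
    then show ?thesis using xy bra(1)[of "{a, b}"] by auto
  next
    fix a b assume "x = Inr a" "y = Inr b"
    then show ?thesis using xy ket(1)[of "{a, b}"] by auto
  next
    fix a b assume "x = Inl a" "y = Inr b"
    then show ?thesis using xy through by auto
  next
    fix a b assume "x = Inr a" "y = Inl b"
    then show ?thesis using xy through[of b a] by auto
  qed
qed

lemma bra_propagating_iff:
  assumes p: "p \<in> C_br n"
  shows "a \<in> propagating (half_of n Inl p) \<longleftrightarrow> (\<exists>b. {Inl a, Inr b} \<in> p)"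
proof
  have part: "partition_on ({1..n} <+> {1..n}) p" using p by (rule C_br_partition)
  {
    assume "a \<in> propagating (half_of n Inl p)"
    then have a: "a \<in> {1..n}" "\<And>B. Inl ` B \<in> p \<Longrightarrow> a \<notin> B"
      using bra.propagating_half_of[OF p] by auto
    then have "Inl a \<in> \<Union>p" using partition_onD1[OF part] by auto
    then obtain A where A: "A \<in> p" "Inl a \<in> A" by blast
    from p A(1) show "\<exists>b. {Inl a, Inr b} \<in> p"
      by (cases rule: C_br_cases) (use A a in auto)
  next
    assume "\<exists>b. {Inl a, Inr b} \<in> p"
    then obtain b where b: "{Inl a, Inr b} \<in> p" by blast
    then have "Inl a \<in> {1..n} <+> {1..n}" using partition_onD1[OF part] by blast
    moreover have "a \<notin> B" if "Inl ` B \<in> p" for B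
    proof
      assume "a \<in> B"
      then have "Inl ` B = {Inl a, Inr b}"
        using partition_on_member_eq[OF part that b, of "Inl a"] by simp
      then show False by auto
    qed
    ultimately show "a \<in> propagating (half_of n Inl p)"
      using bra.propagating_half_of[OF p] by auto
  }
qed

lemma ket_propagating_iff:
  assumes p: "p \<in> C_br n"
  shows "b \<in> propagating (half_of n Inr p) \<longleftrightarrow> (\<exists>a. {Inl a, Inr b} \<in> p)"
proof
  have part: "partition_on ({1..n} <+> {1..n}) p" using p by (rule C_br_partition)
  {
    assume "b \<in> propagating (half_of n Inr p)"
    then have b: "b \<in> {1..n}" "\<And>B. Inr ` B \<in> p \<Longrightarrow> b \<notin> B"
      using ket.propagating_half_of[OF p] by auto
    then have "Inr b \<in> \<Union>p" using partition_onD1[OF part] by auto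
    then obtain A where A: "A \<in> p" "Inr b \<in> A" by blast
    from p A(1) show "\<exists>a. {Inl a, Inr b} \<in> p"
      by (cases rule: C_br_cases) (use A b in auto)
  next
    assume "\<exists>a. {Inl a, Inr b} \<in> p"
    then obtain a where a: "{Inl a, Inr b} \<in> p" by blast
    then have "Inr b \<in> {1..n} <+> {1..n}" using partition_onD1[OF part] by blast
    moreover have "b \<notin> B" if "Inr ` B \<in> p" for B
    proof
      assume "b \<in> B"
      then have "Inr ` B = {Inl a, Inr b}"
        using partition_on_member_eq[OF part that a, of "Inr b"] by simp
      then show False by auto
    qed
    ultimately show "b \<in> propagating (half_of n Inr p)"
      using ket.propagating_half_of[OF p] by auto
  }
qed

lemma through_unique:
  assumes p: "p \<in> C_br n" and "{Inl a, Inr b} \<in> p" "{Inl a', Inr b'} \<in> p"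
  shows "a = a' \<longleftrightarrow> b = b'"
proof
  note eq = partition_on_member_eq[OF C_br_partition[OF p] assms(2,3)]
  show "b = b'" if "a = a'" using eq[of "Inl a"] that by (auto simp: doubleton_eq_iff)
  show "a = a'" if "b = b'" using eq[of "Inr b"] that by (auto simp: doubleton_eq_iff)
qed

definition partner :: "(nat + nat) set set \<Rightarrow> nat \<Rightarrow> nat" where
  "partner p a = (THE b. {Inl a, Inr b} \<in> p)"

lemma partner_eqI: "p \<in> C_br n \<Longrightarrow> {Inl a, Inr b} \<in> p \<Longrightarrow> partner p a = b"
  unfolding partner_def using through_unique by (blast intro: the_equality)

lemma partner_through:
  "p \<in> C_br n \<Longrightarrow> a \<in> propagating (half_of n Inl p) \<Longrightarrow> {Inl a, Inr (partner p a)} \<in> p"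
  using bra_propagating_iff partner_eqI by metis

lemma partner_bij_betw:
  assumes p: "p \<in> C_br n"
  shows "bij_betw (partner p) (propagating (half_of n Inl p)) (propagating (half_of n Inr p))"
proof (rule bij_betwI')
  show "partner p a = partner p a' \<longleftrightarrow> a = a'"
    if "a \<in> propagating (half_of n Inl p)" "a' \<in> propagating (half_of n Inl p)" for a a'
    using through_unique[OF p] partner_through[OF p] that by blast
  show "partner p a \<in> propagating (half_of n Inr p)" if "a \<in> propagating (half_of n Inl p)" for a
    using partner_through[OF p that] ket_propagating_iff[OF p] by blast
  show "\<exists>a\<in>propagating (half_of n Inl p). b = partner p a" if "b \<in> propagating (half_of n Inr p)" for b
    using that ket_propagating_iff[OF p] bra_propagating_iff[OF p] partner_eqI[OF p] by metis
qed

lemma propagating_word_eq: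
  "propagating_word n p =
     map (\<lambda>a. rank (propagating (half_of n Inr p)) (partner p a))
       (sorted_list_of_set (propagating (half_of n Inl p)))"
  by (simp add: propagating_word_def rank_def partner_def)

lemma propagating_word_permutation:
  assumes p: "p \<in> C_br n"
  shows "distinct (propagating_word n p)"
    and "set (propagating_word n p) = {1..length (propagating_word n p)}"
    and "length (propagating_word n p) = card (propagating (half_of n Inl p))"
    and "length (propagating_word n p) = card (propagating (half_of n Inr p))"
proof -
  let ?L = "propagating (half_of n Inl p)" and ?R = "propagating (half_of n Inr p)"
  have fin: "finite ?L" "finite ?R"
    using finite_propagating bra.half_of_half_pair_partition[OF p] ket.half_of_half_pair_partition[OF p]
    by auto
  show len: "length (propagating_word n p) = card ?L"
    by (simp add: propagating_word_eq fin)
  with bij_betw_same_card[OF partner_bij_betw[OF p]]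
  show len': "length (propagating_word n p) = card ?R" by simp
  have "bij_betw (rank ?R \<circ> partner p) ?L {1..card ?R}"
    using partner_bij_betw[OF p] rank_bij_betw[OF fin(2)] by (rule bij_betw_trans)
  then show "distinct (propagating_word n p)"
    "set (propagating_word n p) = {1..length (propagating_word n p)}"
    unfolding len' using fin by (auto simp: propagating_word_eq distinct_map bij_betw_def o_def)
qed

text \<open>
  Parts inside one of the two rows of points are visible in the halves. For a part that joins the two
  rows, the word gives the rank of its primed end among the singletons of the second half.
\<close>

lemma pair_partition_determined:
  assumes p: "p \<in> C_br n" and q: "q \<in> C_br n"
    and bra: "half_of n Inl p = half_of n Inl q" and ket: "half_of n Inr p = half_of n Inr q"
    and word: "propagating_word n p = propagating_word n q"
  shows "p \<subseteq> q"
proof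
  fix A assume A: "A \<in> p"
  let ?L = "propagating (half_of n Inl p)" and ?R = "propagating (half_of n Inr p)"
  have fin: "finite ?L" "finite ?R"
    using finite_propagating bra.half_of_half_pair_partition[OF p] ket.half_of_half_pair_partition[OF p]
    by auto
  from p A show "A \<in> q"
  proof (cases rule: C_br_cases)
    case (bra B)
    with A \<open>half_of n Inl p = half_of n Inl q\<close> show ?thesis using bra.pair_in_half_of_iff by metis
  next
    case (ket B)
    with A \<open>half_of n Inr p = half_of n Inr q\<close> show ?thesis using ket.pair_in_half_of_iff by metis
  next
    case (through a b)
    then have a: "a \<in> ?L" using A bra_propagating_iff[OF p] by blast
    have "rank ?R (partner p a) = rank ?R (partner q a)"
      using word a fin unfolding propagating_word_eq bra[symmetric] ket[symmetric] by auto
    moreover have "partner p a \<in> ?R" "partner q a \<in> ?R"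
      using a bij_betwE[OF partner_bij_betw[OF p]] bij_betwE[OF partner_bij_betw[OF q]] bra ket by auto
    ultimately have "partner p a = partner q a"
      using bij_betw_imp_inj_on[OF rank_bij_betw[OF fin(2)]] by (auto dest: inj_onD)
    moreover have "partner p a = b" using partner_eqI[OF p] A through by blast
    moreover have "{Inl a, Inr (partner q a)} \<in> q" using partner_through[OF q] a bra by simp
    ultimately show ?thesis using through by simp
  qed
qed

text \<open>
  Any two half pair partitions with equally many singletons can be joined along any permutation: match
  the singletons in the way the word prescribes.
\<close>

lemma pair_partition_exists:
  assumes \<sigma>1: "\<sigma>1 \<in> half_pair_partitions n" and \<sigma>2: "\<sigma>2 \<in> half_pair_partitions n"
    and card: "card (propagating \<sigma>1) = length w" "card (propagating \<sigma>2) = length w"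
    and w: "distinct w" "set w = {1..length w}"
  shows "\<exists>p\<in>C_br n. half_of n Inl p = \<sigma>1 \<and> half_of n Inr p = \<sigma>2 \<and> propagating_word n p = w"
proof -
  let ?L = "propagating \<sigma>1" and ?R = "propagating \<sigma>2"
  have fin: "finite ?L" "finite ?R" using finite_propagating \<sigma>1 \<sigma>2 by auto
  define as where "as = sorted_list_of_set ?L"
  have as: "distinct as" "length as = length w" "set as = ?L"
    using fin card by (auto simp: as_def)
  \<comment> \<open>The letter that belongs to the propagating point \<open>a\<close>.\<close>
  define f where "f a = the (map_of (zip as w) a)" for a
  have map_f: "map f as = w"
    by (rule nth_equalityI) (use as in \<open>auto simp: f_def map_of_zip_nth\<close>)
  have inj_f: "inj_on f ?L" using w(1) as(3) unfolding map_f[symmetric] distinct_map by simp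
  have "f ` ?L = {1..length w}"
    unfolding w(2)[symmetric] as(3)[symmetric] set_map[symmetric] map_f by simp
  with inj_f have f: "bij_betw f ?L {1..length w}" by (simp add: bij_betw_def)
  have r: "bij_betw (rank ?R) ?R {1..length w}" using rank_bij_betw[OF fin(2)] card by simp
  \<comment> \<open>The primed point to be joined to \<open>a\<close> is the one whose rank is this letter.\<close>
  define \<beta> where "\<beta> a = inv_into ?R (rank ?R) (f a)" for a
  have \<beta>: "bij_betw \<beta> ?L ?R"
    using bij_betw_trans[OF f bij_betw_inv_into[OF r]] by (simp add: \<beta>_def[abs_def] o_def)
  have rank_\<beta>: "rank ?R (\<beta> a) = f a" if "a \<in> ?L" for a
    unfolding \<beta>_def using bij_betw_inv_into_right[OF r] bij_betwE[OF f] that by blast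
  define p where "p = (`) Inl ` {A \<in> \<sigma>1. card A = 2} \<union> (`) Inr ` {A \<in> \<sigma>2. card A = 2} \<union>
      (\<lambda>a. {Inl a, Inr (\<beta> a)}) ` ?L"
  have part1: "partition_on {1..n} \<sigma>1" and part2: "partition_on {1..n} \<sigma>2"
    using \<sigma>1 \<sigma>2 half_pair_partition_on by auto
  have mem_p: "A \<in> p \<longleftrightarrow> (\<exists>B\<in>\<sigma>1. card B = 2 \<and> A = Inl ` B) \<or> (\<exists>B\<in>\<sigma>2. card B = 2 \<and> A = Inr ` B) \<or>
      (\<exists>a\<in>?L. A = {Inl a, Inr (\<beta> a)})" for A
    unfolding p_def by blast
  have card_p: "card A = 2" if "A \<in> p" for A
    using that unfolding mem_p by (auto simp: bra.card_image_eq ket.card_image_eq)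
  have not_prop1: "a \<notin> B" if "a \<in> ?L" "B \<in> \<sigma>1" "card B = 2" for a B
  proof
    assume "a \<in> B"
    then have "B = {a}"
      using partition_on_member_eq[OF part1, of "{a}" B a] that by (simp add: propagating_def)
    with that(3) show False by simp
  qed
  have not_prop2: "a \<notin> B" if "a \<in> ?R" "B \<in> \<sigma>2" "card B = 2" for a B
  proof
    assume "a \<in> B"
    then have "B = {a}"
      using partition_on_member_eq[OF part2, of "{a}" B a] that by (simp add: propagating_def)
    with that(3) show False by simp
  qed
  have \<beta>R: "\<beta> a \<in> ?R" if "a \<in> ?L" for a using bij_betwE[OF \<beta>] that by blast
  have \<beta>_inj: "a = a'" if "a \<in> ?L" "a' \<in> ?L" "\<beta> a = \<beta> a'" for a a'
    using bij_betw_imp_inj_on[OF \<beta>] that by (auto dest: inj_onD)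
  have cover1: "(\<exists>B\<in>\<sigma>1. card B = 2 \<and> x \<in> B) \<or> x \<in> ?L \<longleftrightarrow> x \<in> {1..n}" for x
    using half_pair_partition_eq[OF \<sigma>1] half_pair_partition_bound[OF \<sigma>1] propagating_subset[OF \<sigma>1]
    by (auto simp: propagating_def)
  have cover2: "(\<exists>B\<in>\<sigma>2. card B = 2 \<and> x \<in> B) \<or> x \<in> ?R \<longleftrightarrow> x \<in> {1..n}" for x
    using half_pair_partition_eq[OF \<sigma>2] half_pair_partition_bound[OF \<sigma>2] propagating_subset[OF \<sigma>2]
    by (auto simp: propagating_def)
  have inl: "Inl x \<in> \<Union>p \<longleftrightarrow> x \<in> {1..n}" for x
    unfolding cover1[symmetric] Union_iff Bex_def mem_p by blast
  have inr: "Inr x \<in> \<Union>p \<longleftrightarrow> x \<in> {1..n}" for x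
  proof -
    have "Inr x \<in> \<Union>p \<longleftrightarrow> (\<exists>B\<in>\<sigma>2. card B = 2 \<and> x \<in> B) \<or> (\<exists>a\<in>?L. x = \<beta> a)"
      unfolding Union_iff Bex_def mem_p by blast
    also have "(\<exists>a\<in>?L. x = \<beta> a) \<longleftrightarrow> x \<in> ?R"
      using bij_betw_imp_surj_on[OF \<beta>] by blast
    finally show ?thesis unfolding cover2 .
  qed
  have "x \<in> \<Union>p \<longleftrightarrow> x \<in> {1..n} <+> {1..n}" for x
    using inl inr by (cases x) (simp_all only: bra.points ket.points)
  then have "\<Union>p = {1..n} <+> {1..n}" by blast
  moreover have "{} \<notin> p" using card_p by fastforce
  moreover have "A = B" if "A \<in> p" "B \<in> p" "x \<in> A" "x \<in> B" for A B x
  proof (cases x)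
    case (Inl a)
    have *: "(\<exists>C\<in>\<sigma>1. card C = 2 \<and> D = Inl ` C \<and> a \<in> C) \<or> (a \<in> ?L \<and> D = {Inl a, Inr (\<beta> a)})"
      if "D \<in> p" "x \<in> D" for D
      using that unfolding mem_p Inl by blast
    show ?thesis
      using *[OF that(1,3)] *[OF that(2,4)] not_prop1 partition_on_member_eq[OF part1] by metis
  next
    case (Inr b)
    have *: "(\<exists>C\<in>\<sigma>2. card C = 2 \<and> D = Inr ` C \<and> b \<in> C) \<or> (\<exists>a\<in>?L. b = \<beta> a \<and> D = {Inl a, Inr b})"
      if "D \<in> p" "x \<in> D" for D
      using that unfolding mem_p Inr by blast
    show ?thesis
      using *[OF that(1,3)] *[OF that(2,4)] not_prop2 \<beta>R \<beta>_inj partition_on_member_eq[OF part2] by metis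
  qed
  then have "disjoint p" unfolding disjoint_def by blast
  ultimately have p: "p \<in> C_br n"
    using card_p by (simp add: C_br_def partition_on_def)
  have bra_half: "half_of n Inl p = \<sigma>1"
  proof (rule half_of_eqI[OF \<sigma>1])
    fix A
    have "(Inl :: nat \<Rightarrow> nat + nat) ` A \<noteq> Inr ` B" if "card B = 2" for B
      using that by (cases "B = {}") (simp, blast)
    moreover have "(Inl :: nat \<Rightarrow> nat + nat) ` A \<noteq> {Inl a, Inr b}" for a b by auto
    moreover have "(Inl :: nat \<Rightarrow> nat + nat) ` A = Inl ` B \<longleftrightarrow> A = B" for B by (simp add: inj_image_eq_iff)
    ultimately show "Inl ` A \<in> p \<longleftrightarrow> A \<in> \<sigma>1 \<and> card A = 2" unfolding mem_p by metis
  qed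
  have ket_half: "half_of n Inr p = \<sigma>2"
  proof (rule half_of_eqI[OF \<sigma>2])
    fix A
    have "(Inr :: nat \<Rightarrow> nat + nat) ` A \<noteq> Inl ` B" if "card B = 2" for B
      using that by (cases "B = {}") (simp, blast)
    moreover have "(Inr :: nat \<Rightarrow> nat + nat) ` A \<noteq> {Inl a, Inr b}" for a b by auto
    moreover have "(Inr :: nat \<Rightarrow> nat + nat) ` A = Inr ` B \<longleftrightarrow> A = B" for B by (simp add: inj_image_eq_iff)
    ultimately show "Inr ` A \<in> p \<longleftrightarrow> A \<in> \<sigma>2 \<and> card A = 2" unfolding mem_p by metis
  qed
  have "partner p a = \<beta> a" if "a \<in> ?L" for a
    using that by (intro partner_eqI[OF p]) (auto simp: mem_p)
  then have "propagating_word n p = map f as"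
    unfolding propagating_word_eq bra_half ket_half as_def[symmetric]
    using as(3) rank_\<beta> by (intro map_cong) auto
  with map_f p bra_half ket_half show ?thesis by blast
qed

lemma robinson_schensted_standard:
  assumes "distinct w" "set w = {1..length w}" "robinson_schensted w = (P, Q)"
  shows "tableau_shape P \<in> int_partitions" "partition_size (tableau_shape P) = length w"
    "P \<in> standard_tableaux (tableau_shape P)" "Q \<in> standard_tableaux (tableau_shape P)"
proof -
  note rs = robinson_schensted_tableaux[OF assms(1,3)]
  show int: "tableau_shape P \<in> int_partitions"
    using rs increasing_tableau_shape by blast
  have "mset (concat P) = mset w" using rs by blast
  then have P: "length (concat P) = length w" "distinct (concat P)" "set (concat P) = set w"
    using assms(1) mset_eq_length mset_eq_imp_distinct_iff mset_eq_setD by blast+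
  then show size: "partition_size (tableau_shape P) = length w"
    by (simp only: partition_size_tableau_shape)
  show "P \<in> standard_tableaux (tableau_shape P)" "Q \<in> standard_tableaux (tableau_shape P)"
    unfolding standard_tableaux_eq[OF int] size tableaux_of_content_def
    using rs P assms(2) content_upTo[of Q "length w"] by (simp_all del: set_concat)
qed

lemma bra_ket_bij_betw: "bij_betw (bra_ket n) (C_br n) (catalan_sets young_graph Y_br n)"
proof (rule bij_betwI')
  fix p q assume p: "p \<in> C_br n" and q: "q \<in> C_br n"
  have "p = q" if eq: "bra_ket n p = bra_ket n q"
  proof -
    have halves: "half_of n Inl p = half_of n Inl q" "half_of n Inr p = half_of n Inr q"
      and rs: "robinson_schensted (propagating_word n p) = robinson_schensted (propagating_word n q)"
      using eq by (auto simp: bra_ket_def split: prod.splits)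
    have "propagating_word n p = propagating_word n q"
      using propagating_word_permutation(1,3)[OF p] propagating_word_permutation(1,3)[OF q] halves rs
      by (intro robinson_schensted_inj) auto
    then show ?thesis
      using pair_partition_determined[OF p q] pair_partition_determined[OF q p] halves by auto
  qed
  then show "bra_ket n p = bra_ket n q \<longleftrightarrow> p = q" by blast
next
  fix p assume p: "p \<in> C_br n"
  obtain P Q where PQ: "robinson_schensted (propagating_word n p) = (P, Q)" by fastforce
  note word = propagating_word_permutation[OF p]
  note rs = robinson_schensted_standard[OF word(1,2) PQ]
  have "half_of n Inl p \<in> half_pair_partitions_with_singletons n (partition_size (tableau_shape P))"
    "half_of n Inr p \<in> half_pair_partitions_with_singletons n (partition_size (tableau_shape P))"
    using bra.half_of_half_pair_partition[OF p] ket.half_of_half_pair_partition[OF p] rs(2) word(3,4)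
    by (simp_all add: half_pair_partitions_with_singletons_def)
  then show "bra_ket n p \<in> catalan_sets young_graph Y_br n"
    using rs PQ by (simp add: bra_ket_def catalan_sets_def Y_br_eq young_graph_def)
next
  fix z assume "z \<in> catalan_sets young_graph Y_br n"
  then obtain \<mu> \<sigma>1 P \<sigma>2 Q where z: "z = (\<mu>, (\<sigma>1, P), (\<sigma>2, Q))" and \<mu>: "\<mu> \<in> int_partitions"
    and \<sigma>: "\<sigma>1 \<in> half_pair_partitions_with_singletons n (partition_size \<mu>)"
      "\<sigma>2 \<in> half_pair_partitions_with_singletons n (partition_size \<mu>)"
    and PQ: "P \<in> standard_tableaux \<mu>" "Q \<in> standard_tableaux \<mu>"
    by (auto simp: catalan_sets_def Y_br_eq young_graph_def)
  have P: "increasing_tableau P" "distinct (concat P)" "set (concat P) = {1..partition_size \<mu>}"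
      "tableau_shape P = \<mu>"
    and Q: "increasing_tableau Q" "distinct (concat Q)" "set (concat Q) = {1..partition_size \<mu>}"
      "tableau_shape Q = \<mu>"
    using PQ unfolding standard_tableaux_eq[OF \<mu>] tableaux_of_content_def by blast+
  then obtain w where w: "distinct w" "mset w = mset (concat P)" "robinson_schensted w = (P, Q)"
    using robinson_schensted_surj[of P Q "partition_size \<mu>"] by metis
  have "set w = {1..partition_size \<mu>}" using mset_eq_setD[OF w(2)] P(3) by (rule trans)
  moreover from this have "length w = partition_size \<mu>"
    using distinct_card[OF w(1)] by simp
  ultimately obtain p where "p \<in> C_br n" "half_of n Inl p = \<sigma>1" "half_of n Inr p = \<sigma>2"
    "propagating_word n p = w"
    using pair_partition_exists[of \<sigma>1 n \<sigma>2 w] \<sigma> w(1) by (auto simp: half_pair_partitions_with_singletons_def)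
  then show "\<exists>p\<in>C_br n. z = bra_ket n p"
    using z P(4) w(3) by (intro bexI[of _ p]) (simp_all add: bra_ket_def)
qed

theorem proposition7p7:
  shows "pascal_array young_graph (\<lambda>_. 0) Y_br \<and>
         (\<forall>n. bij_betw (bra_ket n) (C_br n) (catalan_sets young_graph Y_br n))"
  using Y_br_pascal_array bra_ket_bij_betw by blast

end
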